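(* Let $n\ge 1$. There exist polynomials $\gamma_{n,k}(q)$ with nonnegative integer coefficients, for integers $0\le k\le (n-1)/2$, such that $$\sum_{\sigma\in\mathfrak{S}_n} q^{\mathrm{inv}\,\sigma-\mathrm{exc}\,\sigma}\,t^{\mathrm{exc}\,\sigma}=\sum_{0\le k\le (n-1)/2}\gamma_{n,k}(q)\,t^k(1+t)^{n-1-2k}.$$ Moreover, for every integer $k$ with $0\le k\le (n-1)/2$, $$\gamma_{n,k}(q)=\sum_{\sigma\in\mathfrak{S}_{n,k}} q^{2\cdot(2\text{-}13)\sigma+(31\text{-}2)\sigma},$$ and $\gamma_{n,k}(q)$ is divisible by $q^k(1+q)^k$ in $\mathbb{Z}[q]$.
   Context: $\mathfrak{S}_n$ is the set of permutations of $[n]=\{1,\dots,n\}$, with $\sigma\in\mathfrak{S}_n$ written as $\sigma=\sigma(1)\cdots\sigma(n)$; $q$ and $t$ are indeterminates. Statistics on $\sigma\in\mathfrak{S}_n$: - $\mathrm{inv}\,\sigma$ is the number of inversions, i.e. pairs $(i,j)$ with $1\le i<j\le n$ and $\sigma(i)>\sigma(j)$. - $\mathrm{exc}\,\sigma$ is the number of excedances, i.e. $i\in[n]$ with $i<\sigma(i)$. - $(31\text{-}2)\sigma$ is the number of pairs $(i,j)$ such that $2\le i<j\le n$ and $\sigma(i-1)>\sigma(j)>\sigma(i)$. - $(2\text{-}13)\sigma$ is the number of pairs $(i,j)$ such that $1\le i<j\le n-1$ and $\sigma(j+1)>\sigma(i)>\sigma(j)$. Valleys and double descents: with the convention $\sigma(0)=\sigma(n+1)=0$,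 for $i\in[n]$ the value $\sigma(i)$ is called a valley of $\sigma$ if $\sigma(i-1)>\sigma(i)$ and $\sigma(i)<\sigma(i+1)$, and a double descent of $\sigma$ if $\sigma(i-1)>\sigma(i)$ and $\sigma(i)>\sigma(i+1)$. $\mathfrak{S}_{n,k}$ is the set of permutations $\sigma\in\mathfrak{S}_n$ with exactly $k$ valleys and no double descents. *)

theory Defs
  imports
    "HOL-Combinatorics.Permutations"
    "HOL-Computational_Algebra.Polynomial"
begin

text \<open>A permutation of \<open>{1..n}\<close> is a function \<open>s :: nat \<Rightarrow> nat\<close> with \<open>s permutes {1..n}\<close>;
  such functions are the identity outside \<open>{1..n}\<close>.\<close>

definition inv_count :: "nat \<Rightarrow> (nat \<Rightarrow> nat) \<Rightarrow> nat" where
  "inv_count n s = card {(i, j). 1 \<le> i \<and> i < j \<and> j \<le> n \<and> s i > s j}"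

definition exc_count :: "nat \<Rightarrow> (nat \<Rightarrow> nat) \<Rightarrow> nat" where
  "exc_count n s = card {i \<in> {1..n}. i < s i}"

definition pat_31_2 :: "nat \<Rightarrow> (nat \<Rightarrow> nat) \<Rightarrow> nat" where
  "pat_31_2 n s = card {(i, j). 2 \<le> i \<and> i < j \<and> j \<le> n \<and> s (i - 1) > s j \<and> s j > s i}"

definition pat_2_13 :: "nat \<Rightarrow> (nat \<Rightarrow> nat) \<Rightarrow> nat" where
  "pat_2_13 n s = card {(i, j). 1 \<le> i \<and> i < j \<and> j \<le> n - 1 \<and> s (j + 1) > s i \<and> s i > s j}"

text \<open>The convention \<open>s 0 = s (n + 1) = 0\<close> has to be imposed separately, because
  \<open>s permutes {1..n}\<close> forces \<open>s (n + 1) = n + 1\<close>.\<close>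

definition pad :: "nat \<Rightarrow> (nat \<Rightarrow> nat) \<Rightarrow> nat \<Rightarrow> nat" where
  "pad n s i = (if i \<in> {1..n} then s i else 0)"

definition valleys :: "nat \<Rightarrow> (nat \<Rightarrow> nat) \<Rightarrow> nat set" where
  "valleys n s = {s i |i. i \<in> {1..n} \<and>
     pad n s (i - 1) > pad n s i \<and> pad n s i < pad n s (i + 1)}"

definition double_descents :: "nat \<Rightarrow> (nat \<Rightarrow> nat) \<Rightarrow> nat set" where
  "double_descents n s = {s i |i. i \<in> {1..n} \<and>
     pad n s (i - 1) > pad n s i \<and> pad n s i > pad n s (i + 1)}"

definition perms_valley :: "nat \<Rightarrow> nat \<Rightarrow> (nat \<Rightarrow> nat) set" where
  "perms_valley n k =
     {s. s permutes {1..n} \<and> card (valleys n s) = k \<and> double_descents n s = {}}"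

text \<open>Polynomials in two indeterminates are elements of \<open>\<int>[q][t]\<close>, i.e. polynomials in \<open>t\<close>
  with coefficients in \<open>\<int>[q]\<close>.\<close>

abbreviation q_var :: "int poly" where
  "q_var \<equiv> [:0, 1:]"

abbreviation t_var :: "int poly poly" where
  "t_var \<equiv> [:0, 1:]"

text \<open>The exponent \<open>inv - exc\<close> is a subtraction of natural numbers; it is never truncated.\<close>

lemma exc_count_le_inv_count:
  assumes "s permutes {1..n}"
  shows "exc_count n s \<le> inv_count n s"
proof -
  have inj: "inj_on s {1..n}"
    using assms by (simp add: permutes_inj_on)
  have ex: "\<exists>j. i < j \<and> j \<le> n \<and> s i > s j" if i: "i \<in> {1..n}" "i < s i" for i
  proof (rule ccontr)
    assume neg: "\<not> ?thesis"
    have "s ` {i..n} \<subseteq> {i<..n}"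
    proof
      fix y assume "y \<in> s ` {i..n}"
      then obtain j where j: "j \<in> {i..n}" "y = s j" by blast
      have "s j \<in> {1..n}"
        using j(1) i(1) permutes_in_image[OF assms, of j] by simp
      moreover have "s i \<le> s j"
        using neg j(1) by (cases "j = i") (auto simp: not_less)
      ultimately show "y \<in> {i<..n}" using i(2) j(2) by simp
    qed
    moreover have "inj_on s {i..n}"
      using inj by (rule inj_on_subset) (use i in auto)
    ultimately have "card {i..n} \<le> card {i<..n}"
      by (meson card_inj_on_le finite_greaterThanAtMost)
    then show False using i(1) by (simp add: Suc_diff_le)
  qed
  define E where "E = {i \<in> {1..n}. i < s i}"
  define I where "I = {(i, j). 1 \<le> i \<and> i < j \<and> j \<le> n \<and> s i > s j}"
  have "finite I"
    by (rule finite_subset[of _ "{1..n} \<times> {1..n}"]) (auto simp: I_def)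
  moreover have "E \<subseteq> fst ` I"
  proof
    fix i assume "i \<in> E"
    then obtain j where "i < j" "j \<le> n" "s i > s j" "1 \<le> i"
      using ex[of i] by (auto simp: E_def)
    then have "(i, j) \<in> I" by (simp add: I_def)
    then show "i \<in> fst ` I" by force
  qed
  ultimately have "card E \<le> card I"
    by (meson card_image_le card_mono finite_imageI le_trans)
  then show ?thesis
    by (simp add: exc_count_def inv_count_def E_def I_def)
qed

end

theory Submission
  imports Defs
begin

text \<open>
  Both sides are evaluated by transfer recursions for weighted lattice paths.  Building the permutation
  matrix one row or column at a time gives a recursion for partial rook placements, in which
  \<open>inv\<close> is the size of the Rothe diagram; adding a column and then a row yields
  the path model \<open>exc_path\<close>.  On the other side, a permutation is built by inserting its
  values in decreasing order into blocks, the \<open>i\<close>-th of \<open>c\<close> blocks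
  contributing \<open>i - 1\<close> patterns 31-2 and \<open>c - i\<close> patterns 2-13 to the new
  value; a permutation without double descents is built from peaks, double ascents and valleys only.
  This gives steps of weight \<open>[c]\<close>, a \<open>(q\<^sup>2, q)\<close>-integer.  Level steps carry the
  factor \<open>1 + q t\<close> in \<open>exc_path\<close> as well, and the two transfer matrices
  are conjugate.  Each valley closes a block opened by a peak, and the two steps carry consecutive
  integers \<open>[c] [c + 1]\<close>, a multiple of \<open>q (1 + q)\<close>.
\<close>

section \<open>Sums of powers over ranks\<close>

definition qint :: "'a::comm_ring_1 \<Rightarrow> nat \<Rightarrow> 'a" where
  "qint q n = (\<Sum>i<n. q ^ i)"

lemma qint_0 [simp]: "qint q 0 = 0"
  by (simp add: qint_def)

lemma qint_Suc: "qint q (Suc n) = qint q n + q ^ n"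
  by (simp add: qint_def)

text \<open>The ranks of the elements of \<open>F\<close> are the numbers below
  \<open>card F\<close>, each taken once; a new maximum has rank \<open>card A\<close> and leaves
  the other ranks unchanged.\<close>

lemma sum_power_rank:
  fixes F :: "nat set" and q :: "'a::comm_ring_1"
  assumes "finite F"
  shows "(\<Sum>v\<in>F. q ^ card {u \<in> F. u < v}) = qint q (card F)"
  using assms
proof (induction F rule: finite_linorder_max_induct)
  case (insert b A)
  have "b \<notin> A" using insert by blast
  have "{u \<in> insert b A. u < v} = {u \<in> A. u < v}" if "v \<in> A" for v
    using that insert by auto
  moreover have "{u \<in> insert b A. u < b} = A"
    using insert by auto
  ultimately show ?case
    using insert \<open>b \<notin> A\<close> by (simp add: qint_Suc add.commute)
qed simp

section \<open>Rook placements\<close>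

definition rooks :: "nat \<Rightarrow> nat \<Rightarrow> (nat \<times> nat) set set" where
  "rooks a b = {R. R \<subseteq> {1..a} \<times> {1..b} \<and> inj_on fst R \<and> inj_on snd R}"

text \<open>The Rothe diagram, extended to partial placements: a row or column without a rook is
  treated as if its rook lay beyond the board, so that it removes no cells.\<close>

definition rothe :: "nat \<Rightarrow> nat \<Rightarrow> (nat \<times> nat) set \<Rightarrow> (nat \<times> nat) set" where
  "rothe a b R = {(i, v). i \<in> {1..a} \<and> v \<in> {1..b} \<and>
     (\<forall>u \<le> v. (i, u) \<notin> R) \<and> (\<forall>j \<le> i. (j, v) \<notin> R)}"

definition rook_sum ::
  "'a::comm_ring_1 \<Rightarrow> (nat \<times> nat \<Rightarrow> 'a) \<Rightarrow> nat \<Rightarrow> nat \<Rightarrow> nat \<Rightarrow> 'a" where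
  "rook_sum q w a b r =
     (\<Sum>R | R \<in> rooks a b \<and> card R = r. q ^ card (rothe a b R) * (\<Prod>x\<in>R. w x))"

lemma finite_rooks: "finite (rooks a b)"
  by (rule finite_subset[of _ "Pow ({1..a} \<times> {1..b})"]) (auto simp: rooks_def)

lemma finite_rothe: "finite (rothe a b R)"
  by (rule finite_subset[of _ "{1..a} \<times> {1..b}"]) (auto simp: rothe_def)

lemma rooks_finite: "R \<in> rooks a b \<Longrightarrow> finite R"
  by (rule finite_subset[of _ "{1..a} \<times> {1..b}"]) (auto simp: rooks_def)

lemma rooks_card_le:
  assumes "R \<in> rooks a b"
  shows "card R \<le> a"
proof -
  have "card (fst ` R) \<le> card {1..a}"
    using assms by (intro card_mono) (auto simp: rooks_def)
  moreover have "card (fst ` R) = card R"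
    using assms by (simp add: rooks_def card_image)
  ultimately show ?thesis by simp
qed

lemma converse_eq_swap_image: "R\<inverse> = prod.swap ` R"
  by auto

lemma converse_in_rooks: "R\<inverse> \<in> rooks b a \<longleftrightarrow> R \<in> rooks a b"
proof -
  have "inj_on fst (R\<inverse>) \<longleftrightarrow> inj_on snd R"
    unfolding converse_eq_swap_image using comp_inj_on_iff[of prod.swap R fst] by (simp add: comp_def)
  moreover have "inj_on snd (R\<inverse>) \<longleftrightarrow> inj_on fst R"
    unfolding converse_eq_swap_image using comp_inj_on_iff[of prod.swap R snd] by (simp add: comp_def)
  moreover have "R\<inverse> \<subseteq> {1..b} \<times> {1..a} \<longleftrightarrow> R \<subseteq> {1..a} \<times> {1..b}"
    by auto
  ultimately show ?thesis by (auto simp: rooks_def)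
qed

lemma rothe_converse: "rothe b a (R\<inverse>) = (rothe a b R)\<inverse>"
  by (auto simp: rothe_def)

text \<open>Transposing the board transposes the Rothe diagram. Hence the rule for adding a row also
  yields the one for adding a column.\<close>

lemma rook_sum_converse: "rook_sum q w a b r = rook_sum q (w \<circ> prod.swap) b a r"
  unfolding rook_sum_def
proof (rule sum.reindex_bij_witness[where i = converse and j = converse], goal_cases)
  case (5 R)
  have "(\<Prod>x\<in>R\<inverse>. (w \<circ> prod.swap) x) = (\<Prod>x\<in>R. w x)"
    by (simp add: converse_eq_swap_image prod.reindex)
  then show ?case
    by (simp add: rothe_converse)
qed (simp_all add: converse_in_rooks)

text \<open>If the new row stays empty, each of the \<open>b - r\<close> free columns adds one cell
  to the diagram. If it carries a rook in the free column \<open>v\<close>, only the free columns to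
  the left of \<open>v\<close> add one, so \<open>v\<close> contributes \<open>q\<close> to its rank
  among the free columns, and the sum over \<open>v\<close> is a \<open>q\<close>-integer. No cell
  of an older row is affected.\<close>

lemma rook_sum_row:
  assumes w: "\<And>v. v \<in> {1..b} \<Longrightarrow> w (Suc a, v) = \<tau>"
  shows "rook_sum q w (Suc a) b r = q ^ (b - r) * rook_sum q w a b r +
    (if r = 0 then 0 else \<tau> * qint q (Suc b - r) * rook_sum q w a b (r - 1))"
proof -
  define free where "free R = {1..b} - snd ` R" for R :: "(nat \<times> nat) set"
  have fin_free: "finite (free R)" for R by (simp add: free_def)
  have card_free: "card (free R) = b - card R" if "R \<in> rooks a b" for R
  proof -
    have "card (free R) = card {1..b} - card (snd ` R)"
      unfolding free_def using that rooks_finite[OF that]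
      by (intro card_Diff_subset) (auto simp: rooks_def)
    then show ?thesis using that by (simp add: rooks_def card_image)
  qed
  have free_iff: "u \<in> free R \<longleftrightarrow> u \<in> {1..b} \<and> (\<forall>j. (j, u) \<notin> R)" for u R
    by (force simp: free_def)
  have bound: "j \<le> a" if "R \<in> rooks a b" "(j, u) \<in> R" for R j u
    using that by (auto simp: rooks_def)
  have D0: "rothe (Suc a) b R = rothe a b R \<union> Pair (Suc a) ` free R" if R: "R \<in> rooks a b" for R
  proof (rule set_eqI)
    fix x :: "nat \<times> nat"
    obtain i u where x: "x = (i, u)" by force
    show "x \<in> rothe (Suc a) b R \<longleftrightarrow> x \<in> rothe a b R \<union> Pair (Suc a) ` free R"
    proof (cases "i = Suc a")
      case True
      have "(Suc a, u) \<in> rothe (Suc a) b R \<longleftrightarrow> u \<in> free R"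
        using bound[OF R] by (fastforce simp: free_iff rothe_def)
      then show ?thesis by (auto simp: x True rothe_def)
    qed (auto simp: x rothe_def)
  qed
  \<comment> \<open>The new rook hides the free columns from \<open>v\<close> onwards within its
    row; above it, column \<open>v\<close> keeps its cells because the diagram only looks upwards
    for rooks.\<close>
  have D1: "rothe (Suc a) b (insert (Suc a, v) R) =
      rothe a b R \<union> Pair (Suc a) ` {u \<in> free R. u < v}"
    if R: "R \<in> rooks a b" "v \<in> free R" for R v
  proof (rule set_eqI)
    fix x :: "nat \<times> nat"
    obtain i u where x: "x = (i, u)" by force
    show "x \<in> rothe (Suc a) b (insert (Suc a, v) R) \<longleftrightarrow>
        x \<in> rothe a b R \<union> Pair (Suc a) ` {u \<in> free R. u < v}"
    proof (cases "i = Suc a")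
      case True
      have "(Suc a, u) \<in> rothe (Suc a) b (insert (Suc a, v) R) \<longleftrightarrow> u \<in> free R \<and> u < v"
      proof -
        have nR: "(Suc a, u') \<notin> R" for u'
          using bound[OF R(1), of "Suc a" u'] by auto
        have "(\<forall>u' \<le> u. (Suc a, u') \<notin> insert (Suc a, v) R) \<longleftrightarrow> u < v"
          using nR by (auto simp: not_le[symmetric])
        moreover have "(\<forall>j \<le> Suc a. (j, u) \<notin> insert (Suc a, v) R) \<longleftrightarrow> (\<forall>j. (j, u) \<notin> R)"
          if "u < v"
          using that bound[OF R(1), of _ u] by (auto dest: le_SucI)
        ultimately show ?thesis
          unfolding free_iff rothe_def by auto
      qed
      then show ?thesis by (auto simp: x True rothe_def)
    qed (auto simp: x rothe_def)
  qed
  have cD: "card (rothe a b R \<union> Pair (Suc a) ` F) = card (rothe a b R) + card F"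
    if "finite F" for R F
    using that finite_rothe[of a b R]
    by (subst card_Un_disjoint) (auto simp: rothe_def card_image inj_on_def)
  define X where "X = {R. R \<in> rooks (Suc a) b \<and> card R = r}"
  define X0 where "X0 = {R. R \<in> rooks a b \<and> card R = r}"
  \<comment> \<open>Pairs of a smaller placement and a free column for the new rook. The case
    \<open>r = 0\<close> is split off because \<open>r - 1\<close> would be \<open>0\<close>
    there.\<close>
  define X1 where "X1 = (if r = 0 then {} else Sigma {R. R \<in> rooks a b \<and> card R = r - 1} free)"
  define f where "f R = q ^ card (rothe (Suc a) b R) * (\<Prod>x\<in>R. w x)" for R
  define g :: "(nat \<times> nat) set \<times> nat \<Rightarrow> (nat \<times> nat) set"
    where "g = (\<lambda>(R, v). insert (Suc a, v) R)"
  have notin: "(Suc a, v) \<notin> R" if "R \<in> rooks a b" for R v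
    using that by (auto simp: rooks_def)
  have X: "X = X0 \<union> g ` X1"
  proof (intro equalityI subsetI)
    fix R assume R: "R \<in> X"
    show "R \<in> X0 \<union> g ` X1"
    proof (cases "\<exists>v. (Suc a, v) \<in> R")
      case False
      then have "R \<subseteq> {1..a} \<times> {1..b}"
        using R unfolding X_def rooks_def by (fastforce simp: le_Suc_eq)
      then show ?thesis using R by (auto simp: X_def X0_def rooks_def)
    next
      case True
      then obtain v where v: "(Suc a, v) \<in> R" by blast
      define R' where "R' = R - {(Suc a, v)}"
      have R': "R = insert (Suc a, v) R'" "(Suc a, v) \<notin> R'"
        using v by (auto simp: R'_def)
      have rR: "R \<in> rooks (Suc a) b" using R by (simp add: X_def)
      have sub: "R' \<subseteq> {1..a} \<times> {1..b}"
      proof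
        fix x assume x: "x \<in> R'"
        have "fst x \<noteq> Suc a"
        proof
          assume "fst x = Suc a"
          then have "x = (Suc a, v)"
            using rR x v unfolding rooks_def R'_def by (auto simp: inj_on_def)
          with x R'(2) show False by simp
        qed
        moreover have "x \<in> {1..Suc a} \<times> {1..b}"
          using x rR by (auto simp: R'_def rooks_def)
        ultimately show "x \<in> {1..a} \<times> {1..b}" by (auto simp: le_Suc_eq)
      qed
      then have r': "R' \<in> rooks a b"
        using rR by (auto simp: rooks_def R'_def intro: inj_on_subset)
      have "v \<in> free R'"
        using rR v unfolding free_def rooks_def R'_def by (fastforce simp: inj_on_def)
      moreover have "card R = Suc (card R')"
        using R' rooks_finite[OF r'] by simp
      ultimately have "(R', v) \<in> X1"
        using r' R by (auto simp: X1_def X_def)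
      moreover have "R = g (R', v)" by (simp add: g_def R')
      ultimately show ?thesis by blast
    qed
  next
    fix R assume "R \<in> X0 \<union> g ` X1"
    then show "R \<in> X"
    proof
      assume "R \<in> X0"
      then show ?thesis unfolding X_def X0_def rooks_def by fastforce
    next
      assume "R \<in> g ` X1"
      then obtain R' v where *: "R = insert (Suc a, v) R'" "R' \<in> rooks a b"
        "card R' = r - 1" "v \<in> free R'" "r \<noteq> 0"
        by (auto simp: X1_def g_def split: if_splits)
      then have "card R = r"
        using rooks_finite[OF *(2)] notin[OF *(2)] by simp
      moreover have "R \<in> rooks (Suc a) b"
      proof -
        have "R' \<subseteq> {1..a} \<times> {1..b}" "inj_on fst R'" "inj_on snd R'"
          using *(2) by (simp_all add: rooks_def)
        moreover have "Suc a \<notin> fst ` R'" "v \<notin> snd ` R'" "v \<in> {1..b}"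
          using notin[OF *(2)] *(4) by (auto simp: free_iff)
        ultimately show ?thesis
          unfolding *(1) rooks_def by (auto simp: inj_on_insert)
      qed
      ultimately show ?thesis by (simp add: X_def)
    qed
  qed
  have fin: "finite X0" "finite X1"
    using finite_rooks[of a b] unfolding X0_def X1_def using fin_free
    by (auto intro!: finite_SigmaI elim: finite_subset[rotated])
  \<comment> \<open>The added rook is the only one in row \<open>Suc a\<close>, so it can be read
    off from the enlarged placement and removed again.\<close>
  have inj: "inj_on g X1"
  proof (rule inj_onI)
    fix x y assume *: "x \<in> X1" "y \<in> X1" "g x = g y"
    obtain R u S v where xy: "x = (R, u)" "y = (S, v)" by force
    have RS: "R \<in> rooks a b" "S \<in> rooks a b"
      using * by (auto simp: xy X1_def split: if_splits)
    have eq: "insert (Suc a, u) R = insert (Suc a, v) S"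
      using * by (simp add: xy g_def)
    have uv: "u = v"
      using eq notin[OF RS(1)] notin[OF RS(2)] by blast
    moreover have "R = S"
      using eq notin[OF RS(1)] notin[OF RS(2)] by (simp add: uv insert_ident)
    ultimately show "x = y" by (simp add: xy)
  qed
  have disj: "X0 \<inter> g ` X1 = {}"
    using notin by (auto simp: X0_def g_def)
  have "rook_sum q w (Suc a) b r = (\<Sum>R\<in>X. f R)"
    by (simp add: rook_sum_def X_def f_def)
  also have "\<dots> = (\<Sum>R\<in>X0. f R) + (\<Sum>x\<in>X1. f (g x))"
    unfolding X using fin inj disj by (simp add: sum.union_disjoint sum.reindex)
  also have "(\<Sum>R\<in>X0. f R) = q ^ (b - r) * rook_sum q w a b r"
  proof -
    have "f R = q ^ (b - r) * (q ^ card (rothe a b R) * (\<Prod>x\<in>R. w x))" if "R \<in> X0" for R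
      using that by (auto simp: X0_def f_def D0 cD fin_free card_free power_add mult_ac)
    then show ?thesis
      by (simp add: rook_sum_def X0_def[symmetric] sum_distrib_left)
  qed
  also have "(\<Sum>x\<in>X1. f (g x)) =
      (if r = 0 then 0 else \<tau> * qint q (Suc b - r) * rook_sum q w a b (r - 1))"
  proof (cases "r = 0")
    case False
    have fg: "f (g (R, v)) = \<tau> * (q ^ card (rothe a b R) * (\<Prod>x\<in>R. w x)) * q ^ card {u \<in> free R. u < v}"
      if "R \<in> rooks a b" "v \<in> free R" for R v
    proof -
      have "w (Suc a, v) = \<tau>"
        using that by (intro w) (auto simp: free_def)
      moreover have "finite {u \<in> free R. u < v}" by (simp add: fin_free)
      ultimately show ?thesis
        using that rooks_finite[OF that(1)] notin[OF that(1)]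
        by (simp add: f_def g_def D1 cD power_add mult_ac)
    qed
    have "(\<Sum>x\<in>X1. f (g x)) = (\<Sum>R | R \<in> rooks a b \<and> card R = r - 1. \<Sum>v\<in>free R. f (g (R, v)))"
      using False finite_rooks[of a b] unfolding X1_def
      by (simp add: sum.Sigma fin_free case_prod_unfold)
    also have "\<dots> = (\<Sum>R | R \<in> rooks a b \<and> card R = r - 1.
        \<tau> * (q ^ card (rothe a b R) * (\<Prod>x\<in>R. w x)) * qint q (Suc b - r))"
    proof (rule sum.cong[OF refl], clarify)
      fix R assume R: "R \<in> rooks a b" "card R = r - 1"
      have "(\<Sum>v\<in>free R. f (g (R, v))) =
          \<tau> * (q ^ card (rothe a b R) * (\<Prod>x\<in>R. w x)) * (\<Sum>v\<in>free R. q ^ card {u \<in> free R. u < v})"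
        using fg[OF R(1)] by (simp add: sum_distrib_left)
      also have "(\<Sum>v\<in>free R. q ^ card {u \<in> free R. u < v}) = qint q (Suc b - r)"
        using False R by (subst sum_power_rank) (auto simp: card_free fin_free)
      finally show "(\<Sum>v\<in>free R. f (g (R, v))) =
          \<tau> * (q ^ card (rothe a b R) * (\<Prod>x\<in>R. w x)) * qint q (Suc b - r)" .
    qed
    also have "\<dots> = \<tau> * qint q (Suc b - r) * rook_sum q w a b (r - 1)"
      by (simp add: rook_sum_def sum_distrib_left sum_distrib_right mult_ac)
    finally show ?thesis using False by simp
  qed (simp add: X1_def)
  finally show ?thesis .
qed

lemma rook_sum_column:
  assumes "\<And>i. i \<in> {1..a} \<Longrightarrow> w (i, Suc b) = \<tau>"
  shows "rook_sum q w a (Suc b) r = q ^ (a - r) * rook_sum q w a b r +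
    (if r = 0 then 0 else \<tau> * qint q (Suc a - r) * rook_sum q w a b (r - 1))"
  using rook_sum_row[of a "w \<circ> prod.swap" b \<tau> q r] assms
  by (simp add: rook_sum_converse[of q w])

section \<open>Permutations as full rook placements\<close>

text \<open>With \<open>n\<close> rooks on an \<open>n\<close> by \<open>n\<close> board no row and
  no column is empty, so both projections of the placement are bijections onto
  \<open>{1..n}\<close>.\<close>

lemma bij_betw_permutes_rooks:
  "bij_betw (\<lambda>s. (\<lambda>i. (i, s i)) ` {1..n}) {s. s permutes {1..n}} {R \<in> rooks n n. card R = n}"
  unfolding bij_betw_def
proof (intro conjI equalityI subsetI)
  show "inj_on (\<lambda>s. (\<lambda>i. (i, s i)) ` {1..n}) {s. s permutes {1..n}}"
  proof (rule inj_onI, clarify)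
    fix s s' :: "nat \<Rightarrow> nat"
    assume s: "s permutes {1..n}" "s' permutes {1..n}"
      and eq: "(\<lambda>i. (i, s i)) ` {1..n} = (\<lambda>i. (i, s' i)) ` {1..n}"
    show "s = s'"
    proof
      fix i
      show "s i = s' i"
      proof (cases "i \<in> {1..n}")
        case True
        then have "(i, s i) \<in> (\<lambda>i. (i, s' i)) ` {1..n}"
          unfolding eq[symmetric] by (rule imageI)
        then show ?thesis by blast
      next
        case False
        then show ?thesis using s by (simp add: permutes_not_in)
      qed
    qed
  qed
next
  fix R assume "R \<in> (\<lambda>s. (\<lambda>i. (i, s i)) ` {1..n}) ` {s. s permutes {1..n}}"
  then obtain s where s: "s permutes {1..n}" and R: "R = (\<lambda>i. (i, s i)) ` {1..n}"
    by blast
  have "inj_on fst R"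
    by (auto simp: R inj_on_def)
  moreover have "R \<subseteq> {1..n} \<times> {1..n}"
    unfolding R using permutes_in_image[OF s] by blast
  moreover have "inj_on snd R"
    unfolding R inj_on_def using inj_onD[OF permutes_inj_on[OF s]] by auto
  moreover have "card R = n"
    by (simp add: R card_image inj_on_def)
  ultimately show "R \<in> {R \<in> rooks n n. card R = n}"
    by (simp add: rooks_def)
next
  fix R assume "R \<in> {R \<in> rooks n n. card R = n}"
  then have R: "R \<subseteq> {1..n} \<times> {1..n}" "inj_on fst R" "inj_on snd R" "card R = n"
    by (auto simp: rooks_def)
  have "fst ` R = {1..n}" "snd ` R = {1..n}"
    using R by - (rule card_subset_eq; force simp: card_image)+
  then have bij: "bij_betw fst R {1..n}" "bij_betw snd R {1..n}"
    using R by (simp_all add: bij_betw_def)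
  \<comment> \<open>The column of the rook in row \<open>i\<close>, continued by the identity as
    \<open>permutes\<close> demands.\<close>
  define s where "s i = (if i \<in> {1..n} then snd (inv_into R fst i) else i)" for i
  have "bij_betw (snd \<circ> inv_into R fst) {1..n} {1..n}"
    using bij by (blast intro: bij_betw_trans bij_betw_inv_into)
  then have "bij_betw s {1..n} {1..n}"
    by (rule bij_betw_cong[THEN iffD1, rotated]) (simp add: s_def)
  then have "s permutes {1..n}"
    by (rule bij_imp_permutes) (auto simp: s_def)
  moreover have "R = (\<lambda>i. (i, s i)) ` {1..n}"
  proof -
    have "(fst x, s (fst x)) = x" if "x \<in> R" for x
      using that R by (auto simp: s_def inv_into_f_f)
    then have "(\<lambda>i. (i, s i)) ` fst ` R = R"
      by (simp add: image_image)
    then show ?thesis by (simp add: \<open>fst ` R = {1..n}\<close>)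
  qed
  ultimately show "R \<in> (\<lambda>s. (\<lambda>i. (i, s i)) ` {1..n}) ` {s. s permutes {1..n}}"
    by blast
qed

text \<open>The inversion \<open>(i, j)\<close> corresponds to the cell \<open>(i, s j)\<close>: the
  rook of its row lies further right and the rook of its column further down.\<close>

lemma card_rothe_permutation:
  assumes s: "s permutes {1..n}"
  shows "card (rothe n n ((\<lambda>i. (i, s i)) ` {1..n})) = inv_count n s"
proof -
  have "bij_betw (\<lambda>(i, j). (i, s j)) {(i, j). 1 \<le> i \<and> i < j \<and> j \<le> n \<and> s i > s j}
      (rothe n n ((\<lambda>i. (i, s i)) ` {1..n}))"
    unfolding bij_betw_def
  proof (intro conjI equalityI subsetI)
    show "inj_on (\<lambda>(i, j). (i, s j)) {(i, j). 1 \<le> i \<and> i < j \<and> j \<le> n \<and> s i > s j}"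
      using permutes_inj[OF s] by (auto simp: inj_on_def)
  next
    fix x assume "x \<in> (\<lambda>(i, j). (i, s j)) ` {(i, j). 1 \<le> i \<and> i < j \<and> j \<le> n \<and> s i > s j}"
    then obtain i j where x: "x = (i, s j)" "1 \<le> i" "i < j" "j \<le> n" "s i > s j"
      by auto
    have "s j \<in> {1..n}" using x permutes_in_image[OF s, of j] by auto
    moreover have "k = j" if "s j = s k" for k
      using that permutes_inj[OF s] by (auto simp: inj_on_def)
    ultimately show "x \<in> rothe n n ((\<lambda>i. (i, s i)) ` {1..n})"
      using x by (auto simp: rothe_def)
  next
    fix x assume "x \<in> rothe n n ((\<lambda>i. (i, s i)) ` {1..n})"
    then obtain i v where x: "x = (i, v)" "i \<in> {1..n}" "v \<in> {1..n}"
      "\<forall>u\<le>v. (i, u) \<notin> (\<lambda>i. (i, s i)) ` {1..n}" "\<forall>j\<le>i. (j, v) \<notin> (\<lambda>i. (i, s i)) ` {1..n}"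
      by (auto simp: rothe_def)
    obtain j where j: "v = s j" "j \<in> {1..n}"
      using permutes_image[OF s] x(3) by blast
    have "i < j" using x(5) j by (auto simp: not_le[symmetric])
    moreover have "v < s i" using x(2,4) by (auto simp: not_le[symmetric])
    ultimately show "x \<in> (\<lambda>(i, j). (i, s j)) ` {(i, j). 1 \<le> i \<and> i < j \<and> j \<le> n \<and> s i > s j}"
      using x j by auto
  qed
  then show ?thesis
    by (simp add: inv_count_def bij_betw_same_card)
qed

definition exc_weight :: "'a::comm_ring_1 \<Rightarrow> nat \<times> nat \<Rightarrow> 'a" where
  "exc_weight t = (\<lambda>(i, v). if i < v then t else 1)"

lemma sum_inv_exc_eq_rook_sum:
  "(\<Sum>s | s permutes {1..n}. q ^ inv_count n s * t ^ exc_count n s) =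
     rook_sum q (exc_weight t) n n n"
proof -
  have "(\<Prod>x\<in>(\<lambda>i. (i, s i)) ` {1..n}. exc_weight t x) = t ^ exc_count n s" for s
    by (simp add: prod.reindex inj_on_def exc_weight_def exc_count_def
        prod.inter_filter[symmetric])
  then show ?thesis
    unfolding rook_sum_def
    by (subst sum.reindex_bij_betw[OF bij_betw_permutes_rooks, symmetric])
      (auto simp: card_rothe_permutation simp del: One_nat_def intro!: sum.cong)
qed

section \<open>Lattice paths from alternately added rows and columns\<close>

text \<open>Paths of length \<open>m\<close> from height \<open>0\<close> to height
  \<open>g\<close>; the three summands are a last step up, level and down. The height stands for the
  number of empty rows on a board with \<open>m\<close> rows and \<open>Suc m\<close>
  columns.\<close>

primrec exc_path :: "'a::comm_ring_1 \<Rightarrow> 'a \<Rightarrow> nat \<Rightarrow> nat \<Rightarrow> 'a" where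
  "exc_path q t 0 g = (if g = 0 then 1 else 0)"
| "exc_path q t (Suc m) g =
     (if g = 0 then 0 else q ^ (2 * g) * exc_path q t m (g - 1))
     + qint q (Suc g) * q ^ g * (1 + q * t) * exc_path q t m g
     + t * qint q (Suc g) * qint q (Suc (Suc g)) * exc_path q t m (Suc g)"

lemma exc_path_eq_0: "m < g \<Longrightarrow> exc_path q t m g = 0"
  by (induction m arbitrary: g) auto

lemma rook_sum_eq_0: "a < r \<Longrightarrow> rook_sum q w a b r = 0"
  unfolding rook_sum_def using rooks_card_le by (intro sum.neutral) fastforce

text \<open>Column \<open>Suc m\<close> meets the rows up to \<open>m\<close> strictly above the
  diagonal only, so its weight is constantly \<open>t\<close>.\<close>

lemma rook_sum_exc_column:
  "rook_sum q (exc_weight t) m (Suc m) r = q ^ (m - r) * rook_sum q (exc_weight t) m m r +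
     (if r = 0 then 0 else t * qint q (Suc m - r) * rook_sum q (exc_weight t) m m (r - 1))"
  by (rule rook_sum_column) (simp add: exc_weight_def)

text \<open>Row \<open>Suc m\<close> lies on or below the diagonal, so all its weights are
  \<open>1\<close>.\<close>

lemma rook_sum_exc_row:
  "rook_sum q (exc_weight t) (Suc m) (Suc m) r =
     q ^ (Suc m - r) * rook_sum q (exc_weight t) m (Suc m) r +
     (if r = 0 then 0
      else qint q (Suc (Suc m) - r) * rook_sum q (exc_weight t) m (Suc m) (r - 1))"
  using rook_sum_row[of "Suc m" "exc_weight t" m 1 q r] by (simp add: exc_weight_def)

text \<open>One path step is the addition of a row followed by that of a column. Each of the two may
  or may not receive a rook, which gives one up step, two level steps and one down step; the two
  level steps combine to the factor \<open>1 + q * t\<close>.\<close>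

lemma rook_sum_eq_exc_path:
  "r + g = m \<Longrightarrow> rook_sum q (exc_weight t) m (Suc m) r = exc_path q t m g"
proof (induction m arbitrary: r g)
  case 0
  have "{R. R \<in> rooks 0 (Suc 0) \<and> card R = 0} = {{}}"
    by (auto simp: rooks_def)
  then show ?case
    using 0 by (simp add: rook_sum_def rothe_def)
next
  case (Suc m)
  let ?Y = "rook_sum q (exc_weight t) m (Suc m)"
  let ?S = "rook_sum q (exc_weight t) (Suc m) (Suc m)"
  \<comment> \<open>The intermediate square board with \<open>g'\<close> empty rows. For
    \<open>g' = 0\<close> there would be more rooks than rows before the row was added, and for
    \<open>r' = 0\<close> the path value at height \<open>g'\<close> vanishes, so the conditionals
    of the row rule agree with those here.\<close>
  have S: "?S r' = (if g' = 0 then 0 else q ^ g' * exc_path q t m (g' - 1))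
      + qint q (Suc g') * exc_path q t m g'" if "r' + g' = Suc m" for r' g'
  proof -
    have "Suc m - r' = g'" "Suc (Suc m) - r' = Suc g'" using that by auto
    moreover have "?Y r' = (if g' = 0 then 0 else exc_path q t m (g' - 1))"
      using that Suc.IH[of r' "g' - 1"] rook_sum_eq_0[of m r'] by auto
    moreover have "r' \<noteq> 0 \<Longrightarrow> ?Y (r' - 1) = exc_path q t m g'"
      using that Suc.IH[of "r' - 1" g'] by auto
    moreover have "r' = 0 \<Longrightarrow> exc_path q t m g' = 0"
      using that by (auto intro: exc_path_eq_0)
    ultimately show ?thesis
      by (subst rook_sum_exc_row) auto
  qed
  have "rook_sum q (exc_weight t) (Suc m) (Suc (Suc m)) r = q ^ g * ?S r +
     (if r = 0 then 0 else t * qint q (Suc g) * ?S (r - 1))"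
  proof -
    have "Suc m - r = g" "Suc (Suc m) - r = Suc g" using Suc.prems by auto
    then show ?thesis by (subst rook_sum_exc_column) simp
  qed
  also have "(if r = 0 then 0 else t * qint q (Suc g) * ?S (r - 1)) =
     t * qint q (Suc g) * (q ^ Suc g * exc_path q t m g
       + qint q (Suc (Suc g)) * exc_path q t m (Suc g))"
    using Suc.prems S[of "r - 1" "Suc g"] by (auto simp: exc_path_eq_0)
  also have "?S r = (if g = 0 then 0 else q ^ g * exc_path q t m (g - 1))
      + qint q (Suc g) * exc_path q t m g"
    using Suc.prems by (rule S)
  finally have *: "rook_sum q (exc_weight t) (Suc m) (Suc (Suc m)) r =
    q ^ g * ((if g = 0 then 0 else q ^ g * exc_path q t m (g - 1))
      + qint q (Suc g) * exc_path q t m g) +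
    t * qint q (Suc g) * (q ^ Suc g * exc_path q t m g
       + qint q (Suc (Suc g)) * exc_path q t m (Suc g))" .
  have "q ^ (2 * g) = q ^ g * q ^ g" by (simp add: mult_2 power_add)
  then show ?case
    unfolding * exc_path.simps by (simp add: algebra_simps)
qed

text \<open>A full placement must use the last row, so only the second term of the row rule
  survives, with factor \<open>qint q 1\<close>.\<close>

lemma sum_inv_exc_eq_exc_path:
  "(\<Sum>s | s permutes {1..Suc m}. q ^ inv_count (Suc m) s * t ^ exc_count (Suc m) s) =
     exc_path q t m 0"
  unfolding sum_inv_exc_eq_rook_sum
  by (subst rook_sum_exc_row)
    (simp add: rook_sum_eq_0 rook_sum_eq_exc_path qint_Suc)

section \<open>Words with separators\<close>

definition before :: "'a \<Rightarrow> 'a list \<Rightarrow> 'a list" where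
  "before u xs = takeWhile (\<lambda>x. x \<noteq> u) xs"

fun drops :: "nat \<Rightarrow> nat list \<Rightarrow> nat" where
  "drops u (a # b # xs) = (if u < a \<and> b < u then 1 else 0) + drops u (b # xs)"
| "drops u _ = 0"

text \<open>This concerns the left neighbour of \<open>u\<close>; for the reversed word it concerns
  the right neighbour. The words used later start with \<open>0\<close>, so the prefix before a
  positive \<open>u\<close> is not empty.\<close>

definition big_left :: "nat \<Rightarrow> nat list \<Rightarrow> bool" where
  "big_left u xs \<longleftrightarrow> u < last (before u xs)"

text \<open>The occurrences of 31-2, grouped by the letter in the role of 2. Applied to the reversed
  word this gives the occurrences of 2-13.\<close>

definition drop_stat :: "nat list \<Rightarrow> nat" where
  "drop_stat xs = (\<Sum>u \<in> set xs - {0}. drops u (before u xs))"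

lemma drops_append: "drops u (xs @ y # ys) = drops u (xs @ [y]) + drops u (y # ys)"
  by (induction u xs rule: drops.induct) auto

lemma drops_snoc_small: "y < u \<Longrightarrow> z < u \<Longrightarrow> drops u (xs @ [y]) = drops u (xs @ [z])"
  by (induction u xs rule: drops.induct) auto

lemma drops_small_Cons: "y < u \<Longrightarrow> drops u (y # xs) = drops u xs"
  by (cases xs) simp_all

lemma drops_small_prefix: "\<forall>z\<in>set Z. z < u \<Longrightarrow> drops u (Z @ bs) = drops u bs"
  by (induction Z) (simp_all add: drops_small_Cons)

text \<open>Letters below \<open>u\<close> are interchangeable for \<open>drops u\<close>, and two
  adjacent ones never form a drop across \<open>u\<close>. A separator can therefore stand for any
  nonempty string of smaller values still to be inserted.\<close>

lemma drops_replace: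
  assumes "Z \<noteq> []" "\<forall>z\<in>set Z. z < u" "y < u"
  shows "drops u (as @ Z @ bs) = drops u (as @ y # bs)"
proof -
  obtain z Z' where Z: "Z = z # Z'" using assms(1) by (cases Z) auto
  have "drops u (as @ Z @ bs) = drops u (as @ [z]) + drops u (Z @ bs)"
    unfolding Z using drops_append[of u as z "Z' @ bs"] by simp
  also have "drops u (as @ [z]) = drops u (as @ [y])"
    using assms by (intro drops_snoc_small) (simp_all add: Z)
  also have "drops u (Z @ bs) = drops u (y # bs)"
    using assms by (simp add: drops_small_prefix drops_small_Cons)
  finally show ?thesis by (simp add: drops_append[of u as y bs])
qed

lemma before_append:
  "before u (xs @ ys) = (if u \<in> set xs then before u xs else xs @ before u ys)"
  by (induction xs) (auto simp: before_def)

lemma drops_before_replace: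
  assumes "Z \<noteq> []" "\<forall>z\<in>set Z. z < u" "y < u"
  shows "drops u (before u (as @ Z @ bs)) = drops u (before u (as @ y # bs))"
proof -
  have "u \<notin> set Z" using assms by auto
  then show ?thesis
    using assms drops_replace[OF assms] before_append[of u "[y]" bs]
    by (simp add: before_append)
qed

lemma big_left_replace:
  assumes "Z \<noteq> []" "\<forall>z\<in>set Z. z < u" "y < u"
  shows "big_left u (as @ Z @ bs) \<longleftrightarrow> big_left u (as @ y # bs)"
proof -
  have "u \<notin> set Z" "\<not> u < last Z" using assms by (auto simp: not_less less_imp_le)
  then show ?thesis
    using assms before_append[of u "[y]" bs]
    by (auto simp: big_left_def before_append last_append)
qed

text \<open>Each \<open>0\<close> other than an initial one is preceded by a letter above
  \<open>u\<close>, as no two zeros are adjacent, and so ends a drop; no other letter does.\<close>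

lemma drops_eq_count_zero:
  assumes "successively (\<lambda>a b. a \<noteq> 0 \<or> b \<noteq> 0) xs" "\<forall>x\<in>set xs. x = 0 \<or> u < x" "0 < u"
  shows "drops u xs + (if xs \<noteq> [] \<and> hd xs = 0 then 1 else 0) = count_list xs 0"
  using assms
proof (induction u xs rule: drops.induct)
  case (1 u a b xs)
  then have IH: "drops u (b # xs) + (if b = 0 then 1 else 0) = count_list (b # xs) 0"
    by simp
  have "a = 0 \<or> u < a" "b = 0 \<or> u < b" "a \<noteq> 0 \<or> b \<noteq> 0" "0 < u"
    using "1.prems" by simp_all
  then show ?case
    using IH by (cases "a = 0"; cases "b = 0"; simp)
qed simp_all

text \<open>The values greater than \<open>v\<close> of a permutation form blocks of adjacent positions; a
  separator \<open>0\<close> stands for each gap between them and for each end.\<close>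

definition sep_word :: "nat \<Rightarrow> nat \<Rightarrow> nat list \<Rightarrow> bool" where
  "sep_word n v xs \<longleftrightarrow> xs \<noteq> [] \<and> hd xs = 0 \<and> last xs = 0 \<and>
     successively (\<lambda>a b. a \<noteq> 0 \<or> b \<noteq> 0) xs \<and> distinct (filter (\<lambda>x. x \<noteq> 0) xs) \<and>
     set xs = insert 0 {v<..n}"

text \<open>Words with \<open>c\<close> blocks, hence \<open>Suc c\<close> separators. The last two
  conditions exclude double descents and count valleys. They can be imposed before the word is
  complete, because inserting smaller values does not change whether a neighbour of \<open>u\<close>
  exceeds \<open>u\<close>.\<close>

definition sep_words :: "nat \<Rightarrow> nat \<Rightarrow> nat \<Rightarrow> nat \<Rightarrow> nat list set" where
  "sep_words n v c k = {xs. sep_word n v xs \<and> count_list xs 0 = Suc c \<and>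
     (\<forall>u\<in>{v<..n}. big_left u xs \<longrightarrow> big_left u (rev xs)) \<and>
     card {u\<in>{v<..n}. big_left u xs \<and> big_left u (rev xs)} = k}"

definition pq_weight :: "'a::comm_ring_1 \<Rightarrow> 'a \<Rightarrow> nat list \<Rightarrow> 'a" where
  "pq_weight p q xs = q ^ drop_stat xs * p ^ drop_stat (rev xs)"

lemma sep_word_rev [simp]: "sep_word n v (rev xs) \<longleftrightarrow> sep_word n v xs"
proof -
  have "successively (\<lambda>a b. a \<noteq> 0 \<or> b \<noteq> 0) (rev xs) \<longleftrightarrow>
      successively (\<lambda>a b. a \<noteq> 0 \<or> b \<noteq> 0) xs"
    unfolding successively_rev by (rule arg_cong[where f = "\<lambda>P. successively P xs"]) blast
  moreover have "distinct (filter (\<lambda>x. x \<noteq> 0) (rev xs)) \<longleftrightarrow> distinct (filter (\<lambda>x. x \<noteq> 0) xs)"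
    by (simp only: rev_filter[symmetric] distinct_rev)
  ultimately show ?thesis
    unfolding sep_word_def by (simp only: hd_rev last_rev set_rev rev_is_Nil_conv) blast
qed

lemma finite_sep_words: "finite (sep_words n v c k)"
proof (rule finite_subset)
  show "sep_words n v c k \<subseteq> {xs. set xs \<subseteq> {..n} \<and> length xs = Suc c + (n - v)}"
  proof clarify
    fix xs assume xs: "xs \<in> sep_words n v c k"
    have "length (filter (\<lambda>x. x \<noteq> 0) xs) = card (set (filter (\<lambda>x. x \<noteq> 0) xs))"
      using xs by (intro distinct_card[symmetric]) (simp add: sep_words_def sep_word_def)
    also have "set (filter (\<lambda>x. x \<noteq> 0) xs) = {v<..n}"
      using xs by (auto simp: sep_words_def sep_word_def)
    finally have "length (filter (\<lambda>x. x \<noteq> 0) xs) = n - v" by simp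
    moreover have "(\<lambda>x. x = 0) = (=) (0::nat)" by auto
    then have "length (filter (\<lambda>x. x = 0) xs) = Suc c"
      using xs by (simp add: sep_words_def count_list_eq_length_filter)
    ultimately have "length xs = Suc c + (n - v)"
      using sum_length_filter_compl[of "\<lambda>x. x = 0" xs] by simp
    then show "set xs \<subseteq> {..n} \<and> length xs = Suc c + (n - v)"
      using xs by (auto simp: sep_words_def sep_word_def)
  qed
qed (rule finite_lists_length_eq, simp)

section \<open>Insertion of the next smaller value\<close>

text \<open>\<open>l\<close> and \<open>r\<close> say whether \<open>w\<close> is glued to the block on its
  left and on its right.\<close>

definition ins :: "nat \<Rightarrow> bool \<Rightarrow> bool \<Rightarrow> nat list \<Rightarrow> nat list \<Rightarrow> nat list" where
  "ins w l r as bs = as @ ((if l then [] else [0]) @ w # (if r then [] else [0])) @ bs"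

lemma rev_ins: "rev (ins w l r as bs) = ins w r l (rev bs) (rev as)"
  by (simp add: ins_def)

lemma sep_word_zero_mem:
  assumes "sep_word n v (as @ x # bs)"
  shows "as \<noteq> [] \<Longrightarrow> 0 \<in> set as" "bs \<noteq> [] \<Longrightarrow> 0 \<in> set bs"
proof -
  assume "as \<noteq> []"
  moreover from this have "hd as = 0" using assms by (simp add: sep_word_def)
  ultimately show "0 \<in> set as" using hd_in_set by metis
next
  assume "bs \<noteq> []"
  moreover from this have "last bs = 0" using assms by (simp add: sep_word_def)
  ultimately show "0 \<in> set bs" using last_in_set by metis
qed

lemma insert_Suc_greaterThanAtMost: "v < n \<Longrightarrow> insert (Suc v) {Suc v<..n} = {v<..n}"
  by auto

text \<open>The side conditions ensure that there is a block to glue to: \<open>as\<close> is empty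
  only at the first separator and \<open>bs\<close> only at the last.\<close>

lemma sep_word_ins:
  assumes "v < n" and ys: "sep_word n (Suc v) (as @ 0 # bs)"
    and side: "l \<longrightarrow> as \<noteq> []" "r \<longrightarrow> bs \<noteq> []"
  shows "sep_word n v (ins (Suc v) l r as bs)"
proof -
  let ?w = "Suc v"
  have H: "hd (as @ 0 # bs) = 0" "last (as @ 0 # bs) = 0"
    "successively (\<lambda>a b. a \<noteq> 0 \<or> b \<noteq> 0) (as @ 0 # bs)"
    "distinct (filter (\<lambda>x. x \<noteq> 0) (as @ 0 # bs))"
    and set: "insert 0 (set as \<union> set bs) = insert 0 {?w<..n}"
    using ys by (simp_all add: sep_word_def)
  have "?w \<notin> insert 0 (set as \<union> set bs)" unfolding set by simp
  then have nin: "?w \<notin> set as" "?w \<notin> set bs" by auto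
  have zero: "l \<Longrightarrow> 0 \<in> set as" "r \<Longrightarrow> 0 \<in> set bs"
    using side sep_word_zero_mem[OF ys] by auto
  have "hd (ins ?w l r as bs) = 0"
    using H(1) side unfolding ins_def by (cases as) simp_all
  moreover have "last (ins ?w l r as bs) = 0"
    using H(2) side unfolding ins_def by (cases bs rule: rev_cases) simp_all
  moreover have "successively (\<lambda>a b. a \<noteq> 0 \<or> b \<noteq> 0) (ins ?w l r as bs)"
    using H(3) side unfolding ins_def
    by (cases l; cases r; simp add: successively_append_iff successively_Cons)
  moreover have "distinct (filter (\<lambda>x. x \<noteq> 0) (ins ?w l r as bs))"
    using H(4) nin unfolding ins_def by (cases l; cases r; simp)
  moreover have "set (ins ?w l r as bs) = insert ?w (insert 0 (set as \<union> set bs))"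
    using zero unfolding ins_def by (cases l; cases r; auto)
  then have "set (ins ?w l r as bs) = insert 0 {v<..n}"
    unfolding set insert_commute[of "?w"] insert_Suc_greaterThanAtMost[OF \<open>v < n\<close>] .
  moreover have "ins ?w l r as bs \<noteq> []"
    by (simp add: ins_def)
  ultimately show ?thesis by (simp add: sep_word_def)
qed

text \<open>Insertion is undone by deleting the least value together with any adjacent separators
  and putting a single separator in their place.\<close>

lemma sep_word_ins_cases:
  assumes "v < n" and xs: "sep_word n v xs"
  obtains l r as bs where "xs = ins (Suc v) l r as bs" "sep_word n (Suc v) (as @ 0 # bs)"
    "l \<longrightarrow> as \<noteq> []" "r \<longrightarrow> bs \<noteq> []"
proof -
  let ?w = "Suc v"
  have "?w \<in> set xs" using xs \<open>v < n\<close> by (auto simp: sep_word_def)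
  then obtain as' bs' where split: "xs = as' @ ?w # bs'" by (meson split_list)
  have "as' \<noteq> []" "bs' \<noteq> []" using xs by (auto simp: split sep_word_def)
  \<comment> \<open>The value is glued on a side exactly if its neighbour there is not a
    separator.\<close>
  define l where "l \<longleftrightarrow> last as' \<noteq> 0"
  define r where "r \<longleftrightarrow> hd bs' \<noteq> 0"
  define as where "as = (if l then as' else butlast as')"
  define bs where "bs = (if r then bs' else tl bs')"
  have as': "as' = as @ (if l then [] else [0])"
    using \<open>as' \<noteq> []\<close> append_butlast_last_id[of as'] by (cases l) (simp_all add: as_def l_def, metis append_butlast_last_id)
  have bs': "bs' = (if r then [] else [0]) @ bs"
    using \<open>bs' \<noteq> []\<close> by (cases bs') (auto simp: bs_def r_def)
  have 1: "xs = ins ?w l r as bs" by (simp add: ins_def split as' bs')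
  have side: "l \<longrightarrow> as \<noteq> []" "r \<longrightarrow> bs \<noteq> []"
    using \<open>as' \<noteq> []\<close> \<open>bs' \<noteq> []\<close> by (auto simp: as_def bs_def)
  have nin: "?w \<notin> set as" "?w \<notin> set bs"
    using xs by (auto simp: 1 sep_word_def ins_def)
  have "insert 0 (set as \<union> set bs) = insert 0 (set xs - {?w})"
    using nin unfolding 1 ins_def by auto
  also have "set xs = insert 0 {v<..n}"
    using xs by (simp add: sep_word_def)
  also have "insert 0 (insert 0 {v<..n} - {?w}) = insert 0 {?w<..n}"
    using \<open>v < n\<close> by auto
  finally have set: "insert 0 (set as \<union> set bs) = insert 0 {?w<..n}" .
  have nz: "l \<longrightarrow> last as \<noteq> 0" "r \<longrightarrow> hd bs \<noteq> 0"
    by (auto simp: as_def bs_def l_def r_def)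
  have H: "hd xs = 0" "last xs = 0" "successively (\<lambda>a b. a \<noteq> 0 \<or> b \<noteq> 0) xs"
    "distinct (filter (\<lambda>x. x \<noteq> 0) xs)"
    using xs by (simp_all add: sep_word_def)
  have "hd (as @ 0 # bs) = 0"
    using H(1) unfolding 1 ins_def by (cases as) simp_all
  moreover have "last (as @ 0 # bs) = 0"
    using H(2) unfolding 1 ins_def by (cases bs rule: rev_cases) simp_all
  moreover have "successively (\<lambda>a b. a \<noteq> 0 \<or> b \<noteq> 0) (as @ 0 # bs)"
    using H(3) nz side unfolding 1 ins_def
    by (cases l; cases r; simp add: successively_append_iff successively_Cons)
  moreover have "distinct (filter (\<lambda>x. x \<noteq> 0) (as @ 0 # bs))"
    using H(4) unfolding 1 ins_def by (cases l; cases r; simp)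
  ultimately have "sep_word n ?w (as @ 0 # bs)"
    using set by (simp add: sep_word_def)
  with 1 side that show ?thesis by blast
qed

lemma ins_inject:
  assumes "ins w l r as bs = ins w l r as' bs'"
    and "w \<notin> set as" "w \<notin> set as'" "w \<noteq> 0"
  shows "as = as' \<and> bs = bs'"
proof -
  have "before w (ins w l r as bs) = as @ (if l then [] else [0])"
    "before w (ins w l r as' bs') = as' @ (if l then [] else [0])"
    using assms(2-4) by (simp_all add: ins_def before_append) (simp_all add: before_def)
  then have "as = as'" using assms(1) by simp
  then show ?thesis using assms(1) by (simp add: ins_def)
qed

lemma before_ins:
  assumes "w \<notin> set as" "w \<noteq> 0"
  shows "before w (ins w l r as bs) = as @ (if l then [] else [0])"
  using assms by (simp add: ins_def before_append) (simp add: before_def)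

lemma count_list_ins:
  "w \<noteq> 0 \<Longrightarrow> count_list (ins w l r as bs) 0 =
     count_list as 0 + of_bool (\<not> l) + of_bool (\<not> r) + count_list bs 0"
  by (simp add: ins_def)

text \<open>If glued on the left, \<open>w\<close> follows the last letter of \<open>as\<close>.
  This letter stands next to a separator, so it is not one itself and exceeds
  \<open>w\<close>.\<close>

lemma big_left_ins_new:
  assumes ys: "sep_word n w (as @ 0 # bs)" and "l \<longrightarrow> as \<noteq> []" "w \<noteq> 0"
  shows "big_left w (ins w l r as bs) \<longleftrightarrow> l"
proof -
  have set: "set as \<subseteq> insert 0 {w<..n}"
    using ys by (auto simp: sep_word_def)
  then have b: "before w (ins w l r as bs) = as @ (if l then [] else [0])"
    using \<open>w \<noteq> 0\<close> by (intro before_ins) auto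
  show ?thesis
  proof (cases l)
    case True
    then have "last as \<in> set as" "last as \<noteq> 0"
      using assms by (auto simp: sep_word_def successively_append_iff)
    then show ?thesis
      unfolding big_left_def b using set by auto
  next
    case False
    then show ?thesis unfolding big_left_def b by simp
  qed
qed

lemma big_left_ins_old:
  assumes "w < u"
  shows "big_left u (ins w l r as bs) \<longleftrightarrow> big_left u (as @ 0 # bs)"
  unfolding ins_def using assms by (intro big_left_replace) auto

text \<open>Larger values keep their counts, since for them \<open>w\<close> acts like a separator.
  The new value is passed by one drop for each separator before it except the first, which amounts
  to the number of blocks to the left of the one containing \<open>w\<close>.\<close>

lemma drop_stat_ins:
  assumes "v < n" and ys: "sep_word n (Suc v) (as @ 0 # bs)"
    and side: "l \<longrightarrow> as \<noteq> []" "r \<longrightarrow> bs \<noteq> []"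
  shows "drop_stat (ins (Suc v) l r as bs) =
    drop_stat (as @ 0 # bs) + (count_list as 0 - of_bool l)"
proof -
  let ?w = "Suc v" and ?xs = "ins (Suc v) l r as bs"
  have "set ?xs - {0} = insert 0 {v<..n} - {0}"
    using sep_word_ins[OF assms] by (simp only: sep_word_def)
  also have "\<dots> = insert ?w {?w<..n}"
    by (simp add: insert_Suc_greaterThanAtMost[OF \<open>v < n\<close>, symmetric])
  finally have "set ?xs - {0} = insert ?w {?w<..n}" .
  moreover have "set (as @ 0 # bs) - {0} = insert 0 {?w<..n} - {0}"
    using ys by (simp only: sep_word_def)
  then have "set (as @ 0 # bs) - {0} = {?w<..n}" by simp
  moreover have "drops u (before u ?xs) = drops u (before u (as @ 0 # bs))" if "?w < u" for u
    unfolding ins_def using that by (intro drops_before_replace) auto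
  ultimately have "drop_stat ?xs = drop_stat (as @ 0 # bs) + drops ?w (before ?w ?xs)"
    unfolding drop_stat_def by simp
  also have "drops ?w (before ?w ?xs) = count_list as 0 - of_bool l"
  proof -
    have set: "set as \<subseteq> insert 0 {?w<..n}"
      using ys by (auto simp: sep_word_def)
    then have b: "before ?w ?xs = as @ (if l then [] else [0])"
      by (intro before_ins) auto
    have "drops ?w (before ?w ?xs) + (if before ?w ?xs \<noteq> [] \<and> hd (before ?w ?xs) = 0 then 1 else 0)
        = count_list (before ?w ?xs) 0"
    proof (rule drops_eq_count_zero)
      have "successively (\<lambda>a b. a \<noteq> 0 \<or> b \<noteq> 0) (as @ [0] @ bs)"
        using ys by (simp add: sep_word_def)
      then show "successively (\<lambda>a b. a \<noteq> 0 \<or> b \<noteq> 0) (before ?w ?xs)"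
        unfolding b by (simp add: successively_append_iff)
      show "\<forall>x\<in>set (before ?w ?xs). x = 0 \<or> ?w < x"
        using set unfolding b by auto
    qed simp
    moreover have "as = [] \<or> hd as = 0"
      using ys by (cases as) (simp_all add: sep_word_def)
    then have "before ?w ?xs \<noteq> []" "hd (before ?w ?xs) = 0"
      using side(1) unfolding b by (auto simp: hd_append)
    ultimately show ?thesis unfolding b by (cases l) simp_all
  qed
  finally show ?thesis .
qed

lemma pq_weight_ins:
  assumes "v < n" "sep_word n (Suc v) (as @ 0 # bs)" "l \<longrightarrow> as \<noteq> []" "r \<longrightarrow> bs \<noteq> []"
  shows "pq_weight p q (ins (Suc v) l r as bs) = pq_weight p q (as @ 0 # bs) *
    (q ^ (count_list as 0 - of_bool l) * p ^ (count_list bs 0 - of_bool r))"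
proof -
  have "drop_stat (rev (ins (Suc v) l r as bs)) =
      drop_stat (rev bs @ 0 # rev as) + (count_list (rev bs) 0 - of_bool r)"
    unfolding rev_ins using assms sep_word_rev[of n "Suc v" "as @ 0 # bs"]
    by (intro drop_stat_ins) auto
  then show ?thesis
    unfolding pq_weight_def using drop_stat_ins[OF assms]
    by (simp add: power_add mult_ac)
qed

text \<open>A splitting at a zero is determined by the number of zeros before it. Finiteness is
  proved in the same induction because the step needs it to split the sum.\<close>

lemma sum_splits_at_zero:
  fixes f :: "nat \<Rightarrow> nat \<Rightarrow> 'a::comm_monoid_add"
  shows "finite {(as, bs). as @ 0 # bs = (ys::nat list)} \<and>
    (\<Sum>(as, bs) | as @ 0 # bs = ys. f (count_list as 0) (count_list bs 0)) =
      (\<Sum>a<count_list ys 0. f a (count_list ys 0 - 1 - a))"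
proof (induction ys arbitrary: f)
  case (Cons y ys)
  let ?S = "{(as, bs). as @ 0 # bs = ys}" and ?h = "\<lambda>(as, bs). (y # as, bs)"
  have S: "{(as, bs). as @ 0 # bs = y # ys} = (if y = 0 then {([], ys)} else {}) \<union> ?h ` ?S"
    by (auto simp: Cons_eq_append_conv append_eq_Cons_conv)
  have inj: "inj_on ?h ?S" by (auto simp: inj_on_def)
  have fin: "finite ?S" using Cons.IH by blast
  have disj: "(if y = 0 then {([], ys)} else {}) \<inter> ?h ` ?S = {}" by auto
  let ?g = "\<lambda>(as, bs). f (count_list as 0) (count_list bs 0)"
  have "sum ?g {(as, bs). as @ 0 # bs = y # ys} =
      (if y = 0 then f 0 (count_list ys 0) else 0) + sum ?g (?h ` ?S)"
    unfolding S using fin disj by (subst sum.union_disjoint) auto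
  also have "sum ?g (?h ` ?S) = (\<Sum>(as, bs)\<in>?S. f (of_bool (y = 0) + count_list as 0) (count_list bs 0))"
    unfolding sum.reindex[OF inj] by (intro sum.cong) auto
  also have "\<dots> = (\<Sum>a<count_list ys 0. f (of_bool (y = 0) + a) (count_list ys 0 - 1 - a))"
    using Cons.IH[of "\<lambda>a. f (of_bool (y = 0) + a)"] by blast
  finally have "sum ?g {(as, bs). as @ 0 # bs = y # ys} =
    (\<Sum>a<count_list (y # ys) 0. f a (count_list (y # ys) 0 - 1 - a))"
    by (auto simp: sum.lessThan_Suc_shift simp del: sum.lessThan_Suc)
  moreover have "finite {(as, bs). as @ 0 # bs = y # ys}"
    unfolding S using fin by simp
  ultimately show ?case by blast
qed simp

text \<open>The \<open>(p, q)\<close>-analogue of the number \<open>c\<close>.\<close>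

definition pqint :: "'a::comm_ring_1 \<Rightarrow> 'a \<Rightarrow> nat \<Rightarrow> 'a" where
  "pqint p q c = (\<Sum>a<c. q ^ a * p ^ (c - 1 - a))"

definition splits :: "nat \<Rightarrow> bool \<Rightarrow> bool \<Rightarrow> nat list \<Rightarrow> (nat list \<times> nat list) set" where
  "splits x l r ys = {(as, bs). as @ x # bs = ys \<and> (l \<longrightarrow> as \<noteq> []) \<and> (r \<longrightarrow> bs \<noteq> [])}"

lemma finite_splits: "finite (splits 0 l r ys)"
  by (rule finite_subset[OF _ conjunct1[OF sum_splits_at_zero[of ys]]]) (auto simp: splits_def)

text \<open>Gluing on the left rules out the first separator and gluing on the right the last one,
  so \<open>c\<close> places remain. The subtracted \<open>of_bool\<close> terms make the exponents
  on them run through \<open>0\<close> to \<open>c - 1\<close> in opposite directions.\<close>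

lemma sum_splits_eq_pqint:
  assumes ys: "sep_word n v ys" and c: "count_list ys 0 = c + of_bool l + of_bool r"
  shows "(\<Sum>(as, bs)\<in>splits 0 l r ys.
      q ^ (count_list as 0 - of_bool l) * p ^ (count_list bs 0 - of_bool r)) = pqint p q c"
proof -
  \<comment> \<open>The summand continued by \<open>0\<close> to the excluded places, expressed
    through the two counts alone. This is possible because a nonempty side always contains a
    separator.\<close>
  define f where "f a b = (if (l \<longrightarrow> 0 < a) \<and> (r \<longrightarrow> 0 < b)
      then q ^ (a - of_bool l) * p ^ (b - of_bool r) else 0)" for a b
  have zero: "(0 < count_list as 0 \<longleftrightarrow> as \<noteq> []) \<and> (0 < count_list bs 0 \<longleftrightarrow> bs \<noteq> [])"
    if "as @ 0 # bs = ys" for as bs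
  proof -
    have "as \<noteq> [] \<Longrightarrow> 0 \<in> set as" "bs \<noteq> [] \<Longrightarrow> 0 \<in> set bs"
      using ys that sep_word_zero_mem[of n v as 0 bs] by auto
    then show ?thesis
      by (auto simp: count_list_0_iff neq0_conv[symmetric] simp del: neq0_conv)
  qed
  have "(\<Sum>(as, bs)\<in>splits 0 l r ys.
      q ^ (count_list as 0 - of_bool l) * p ^ (count_list bs 0 - of_bool r)) =
      (\<Sum>(as, bs) | as @ 0 # bs = ys. f (count_list as 0) (count_list bs 0))"
    using zero conjunct1[OF sum_splits_at_zero[of ys]]
    by (intro sum.mono_neutral_cong_left) (auto simp: splits_def f_def)
  also have "\<dots> = (\<Sum>a<count_list ys 0. f a (count_list ys 0 - 1 - a))"
    using sum_splits_at_zero by blast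
  also have "\<dots> = pqint p q c"
  proof (cases l)
    case True
    then have "(\<Sum>a<count_list ys 0. f a (count_list ys 0 - 1 - a)) =
      (\<Sum>a<c + of_bool r. f (Suc a) (c + of_bool r - 1 - a))"
      unfolding c by (simp add: sum.lessThan_Suc_shift f_def del: sum.lessThan_Suc)
    also have "\<dots> = pqint p q c"
      using True by (cases r) (auto simp: f_def pqint_def intro!: sum.cong)
    finally show ?thesis .
  next
    case False
    then show ?thesis
      unfolding c by (cases r) (auto simp: f_def pqint_def intro!: sum.cong)
  qed
  finally show ?thesis .
qed

lemma card_insert_filter:
  assumes "finite A" "w \<notin> A" "P w \<longleftrightarrow> b"
  shows "card {u \<in> insert w A. P u} = card {u \<in> A. P u} + of_bool b"
proof -
  have "{u \<in> insert w A. P u} = (if b then {w} else {}) \<union> {u \<in> A. P u}"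
    using assms(3) by auto
  then show ?thesis using assms(1,2) by (cases b) simp_all
qed

text \<open>Only the new value can change the status of the word: it is a double descent if glued on
  the left alone, and a valley if glued on both sides. The positivity condition guards the
  subtraction of \<open>1\<close>, since a lone new block cannot leave zero blocks.\<close>

lemma ins_mem_sep_words:
  assumes "v < n" and ys: "sep_word n (Suc v) (as @ 0 # bs)"
    and side: "l \<longrightarrow> as \<noteq> []" "r \<longrightarrow> bs \<noteq> []"
  shows "ins (Suc v) l r as bs \<in> sep_words n v c k \<longleftrightarrow>
    (l \<longrightarrow> r) \<and>
    (\<exists>k'. k = k' + of_bool (l \<and> r) \<and> as @ 0 # bs \<in> sep_words n (Suc v) (c + of_bool l + of_bool r - 1) k') \<and>
    0 < c + of_bool l + of_bool r"
proof -
  let ?w = "Suc v" and ?xs = "ins (Suc v) l r as bs" and ?ys = "as @ 0 # bs"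
  define A where "A = {?w<..n}"
  have A: "{v<..n} = insert ?w A" "finite A" "?w \<notin> A" "\<And>u. u \<in> A \<Longrightarrow> ?w < u"
    by (simp_all add: A_def insert_Suc_greaterThanAtMost[OF \<open>v < n\<close>])
  have ys': "sep_word n ?w (rev bs @ 0 # rev as)"
    using ys sep_word_rev[of n ?w ?ys] by simp
  have new: "big_left ?w ?xs \<longleftrightarrow> l" "big_left ?w (rev ?xs) \<longleftrightarrow> r"
    using big_left_ins_new[OF ys, of l r] big_left_ins_new[OF ys', of r l] side
    by (simp_all add: rev_ins)
  have old: "big_left u ?xs \<longleftrightarrow> big_left u ?ys" "big_left u (rev ?xs) \<longleftrightarrow> big_left u (rev ?ys)"
    if "u \<in> A" for u
    using A(4)[OF that] by (simp_all add: rev_ins big_left_ins_old)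
  have xs: "sep_word n v ?xs" using assms by (rule sep_word_ins)
  have cnt: "count_list ?xs 0 = Suc c \<longleftrightarrow> count_list ?ys 0 = c + of_bool l + of_bool r"
    by (cases l; cases r; simp add: count_list_ins)
  have "(\<forall>u\<in>{v<..n}. big_left u ?xs \<longrightarrow> big_left u (rev ?xs)) \<longleftrightarrow>
      (l \<longrightarrow> r) \<and> (\<forall>u\<in>A. big_left u ?ys \<longrightarrow> big_left u (rev ?ys))"
    unfolding A(1) by (simp only: ball_simps new old cong: ball_cong)
  moreover have "card {u\<in>{v<..n}. big_left u ?xs \<and> big_left u (rev ?xs)} =
      card {u\<in>A. big_left u ?ys \<and> big_left u (rev ?ys)} + of_bool (l \<and> r)"
  proof -
    have "card {u\<in>{v<..n}. big_left u ?xs \<and> big_left u (rev ?xs)} =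
        card {u\<in>A. big_left u ?xs \<and> big_left u (rev ?xs)} + of_bool (l \<and> r)"
      unfolding A(1) using A(2,3) by (rule card_insert_filter) (simp only: new)
    also have "{u\<in>A. big_left u ?xs \<and> big_left u (rev ?xs)} =
        {u\<in>A. big_left u ?ys \<and> big_left u (rev ?ys)}"
      by (simp only: old cong: conj_cong)
    finally show ?thesis .
  qed
  ultimately show ?thesis
    using xs ys unfolding sep_words_def mem_Collect_eq cnt A_def[symmetric] by auto
qed

section \<open>The recursion for weighted words\<close>

definition word_sum :: "'a::comm_ring_1 \<Rightarrow> 'a \<Rightarrow> nat \<Rightarrow> nat \<Rightarrow> nat \<Rightarrow> nat \<Rightarrow> 'a" where
  "word_sum p q n v c k = (\<Sum>xs\<in>sep_words n v c k. pq_weight p q xs)"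

definition ins_class :: "nat \<Rightarrow> nat \<Rightarrow> bool \<Rightarrow> bool \<Rightarrow> nat \<Rightarrow> nat \<Rightarrow> nat list set" where
  "ins_class n w l r c k =
     (\<lambda>(as, bs). ins w l r as bs) ` (\<Union>ys\<in>sep_words n w c k. splits 0 l r ys)"

text \<open>Here \<open>c'\<close> counts the blocks before and \<open>c\<close> those after the
  insertion. The sum over the admissible places is the same for every word with \<open>c'\<close>
  blocks and factors out.\<close>

lemma sum_ins_class:
  assumes "v < n" and c: "Suc c' = c + of_bool l + of_bool r"
  shows "(\<Sum>xs\<in>ins_class n (Suc v) l r c' k. pq_weight p q xs) =
    pqint p q c * word_sum p q n (Suc v) c' k"
proof -
  let ?w = "Suc v" and ?Y = "sep_words n (Suc v) c' k"
  have sw: "sep_word n ?w (as @ 0 # bs)" if "(as, bs) \<in> splits 0 l r ys" "ys \<in> ?Y" for as bs ys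
    using that by (auto simp: splits_def sep_words_def)
  have nin: "?w \<notin> set as" if "(as, bs) \<in> splits 0 l r ys" "ys \<in> ?Y" for as bs ys
  proof -
    have "set (as @ 0 # bs) = insert 0 {?w<..n}"
      using sw[OF that] by (simp only: sep_word_def)
    moreover have "?w \<notin> insert 0 {?w<..n}" by simp
    ultimately have "?w \<notin> set (as @ 0 # bs)" by metis
    then show ?thesis by simp
  qed
  have inj: "inj_on (\<lambda>(as, bs). ins ?w l r as bs) (\<Union>ys\<in>?Y. splits 0 l r ys)"
  proof (rule inj_onI, clarify)
    fix as bs as' bs' ys ys'
    assume "ys \<in> ?Y" "(as, bs) \<in> splits 0 l r ys" "ys' \<in> ?Y" "(as', bs') \<in> splits 0 l r ys'"
      "ins ?w l r as bs = ins ?w l r as' bs'"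
    then show "as = as' \<and> bs = bs'"
      using nin by (intro ins_inject) blast+
  qed
  have "(\<Sum>xs\<in>ins_class n ?w l r c' k. pq_weight p q xs) =
      (\<Sum>(as, bs)\<in>(\<Union>ys\<in>?Y. splits 0 l r ys). pq_weight p q (ins ?w l r as bs))"
    unfolding ins_class_def sum.reindex[OF inj] by (simp add: case_prod_unfold)
  also have "\<dots> = (\<Sum>ys\<in>?Y. \<Sum>(as, bs)\<in>splits 0 l r ys. pq_weight p q (ins ?w l r as bs))"
    using finite_sep_words finite_splits
    by (intro sum.UNION_disjoint) (auto simp: splits_def)
  also have "\<dots> = (\<Sum>ys\<in>?Y. pqint p q c * pq_weight p q ys)"
  proof (rule sum.cong[OF refl])
    fix ys assume ys: "ys \<in> ?Y"
    have "(\<Sum>(as, bs)\<in>splits 0 l r ys. pq_weight p q (ins ?w l r as bs)) =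
        (\<Sum>(as, bs)\<in>splits 0 l r ys. pq_weight p q ys *
          (q ^ (count_list as 0 - of_bool l) * p ^ (count_list bs 0 - of_bool r)))"
    proof (rule sum.cong[OF refl], clarify)
      fix as bs assume s: "(as, bs) \<in> splits 0 l r ys"
      have "pq_weight p q (ins ?w l r as bs) = pq_weight p q (as @ 0 # bs) *
          (q ^ (count_list as 0 - of_bool l) * p ^ (count_list bs 0 - of_bool r))"
        using s by (intro pq_weight_ins[OF \<open>v < n\<close> sw[OF s ys]]) (auto simp: splits_def)
      then show "pq_weight p q (ins ?w l r as bs) = pq_weight p q ys *
          (q ^ (count_list as 0 - of_bool l) * p ^ (count_list bs 0 - of_bool r))"
        using s by (simp add: splits_def)
    qed
    also have "\<dots> = pq_weight p q ys * pqint p q c"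
    proof -
      have "sep_word n ?w ys" "count_list ys 0 = c + of_bool l + of_bool r"
        using ys c by (simp_all add: sep_words_def)
      from sum_splits_eq_pqint[OF this, of q p] show ?thesis
        by (simp add: sum_distrib_left[symmetric] case_prod_unfold)
    qed
    finally show "(\<Sum>(as, bs)\<in>splits 0 l r ys. pq_weight p q (ins ?w l r as bs)) =
      pqint p q c * pq_weight p q ys" by (simp add: mult.commute)
  qed
  finally show ?thesis by (simp add: word_sum_def sum_distrib_left)
qed

text \<open>The kind of insertion can be recovered from the result: \<open>big_left\<close> of the
  new value gives \<open>l\<close>, on the reversed word it gives \<open>r\<close>, and the position
  of the new value then gives the two parts.\<close>

lemma mem_ins_class_iff:
  assumes "v < n" "sep_word n (Suc v) (as @ 0 # bs)" "l \<longrightarrow> as \<noteq> []" "r \<longrightarrow> bs \<noteq> []"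
  shows "ins (Suc v) l r as bs \<in> ins_class n (Suc v) l' r' c k \<longleftrightarrow>
    l' = l \<and> r' = r \<and> as @ 0 # bs \<in> sep_words n (Suc v) c k"
proof
  assume "ins (Suc v) l r as bs \<in> ins_class n (Suc v) l' r' c k"
  then obtain as' bs' where *: "ins (Suc v) l r as bs = ins (Suc v) l' r' as' bs'"
    "as' @ 0 # bs' \<in> sep_words n (Suc v) c k" "l' \<longrightarrow> as' \<noteq> []" "r' \<longrightarrow> bs' \<noteq> []"
    by (auto simp: ins_class_def splits_def)
  have sw: "sep_word n (Suc v) (as' @ 0 # bs')" using *(2) by (simp add: sep_words_def)
  have rev: "sep_word n (Suc v) (rev bs @ 0 # rev as)" "sep_word n (Suc v) (rev bs' @ 0 # rev as')"
    using assms(2) sw sep_word_rev[of n "Suc v" "as @ 0 # bs"]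
      sep_word_rev[of n "Suc v" "as' @ 0 # bs'"] by simp_all
  have "l' = l"
    using big_left_ins_new[OF assms(2), of l r] big_left_ins_new[OF sw, of l' r'] * assms by simp
  moreover have "rev (ins (Suc v) l r as bs) = rev (ins (Suc v) l' r' as' bs')"
    using *(1) by simp
  then have "r' = r"
    using big_left_ins_new[OF rev(1), of r l] big_left_ins_new[OF rev(2), of r' l'] * assms
    unfolding rev_ins by simp
  moreover have "Suc v \<notin> set (xs @ 0 # ys)" if "sep_word n (Suc v) (xs @ 0 # ys)" for xs ys
  proof -
    have "set (xs @ 0 # ys) = insert 0 {Suc v<..n}"
      using that by (simp only: sep_word_def)
    moreover have "Suc v \<notin> insert 0 {Suc v<..n}" by simp
    ultimately show ?thesis by metis
  qed
  then have "Suc v \<notin> set as" "Suc v \<notin> set as'"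
    using assms(2) sw by fastforce+
  ultimately have "as = as' \<and> bs = bs'"
    using *(1) by (intro ins_inject[of "Suc v" l r]) simp_all
  then show "l' = l \<and> r' = r \<and> as @ 0 # bs \<in> sep_words n (Suc v) c k"
    using *(2) \<open>l' = l\<close> \<open>r' = r\<close> by simp
next
  assume "l' = l \<and> r' = r \<and> as @ 0 # bs \<in> sep_words n (Suc v) c k"
  then show "ins (Suc v) l r as bs \<in> ins_class n (Suc v) l' r' c k"
    unfolding ins_class_def splits_def using assms(3,4) by force
qed

lemma ins_class_subset:
  assumes "v < n" "xs \<in> ins_class n (Suc v) l r c k"
  obtains as bs where "xs = ins (Suc v) l r as bs" "sep_word n (Suc v) (as @ 0 # bs)"
    "l \<longrightarrow> as \<noteq> []" "r \<longrightarrow> bs \<noteq> []"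
  using assms by (auto simp: ins_class_def splits_def sep_words_def)

text \<open>The three classes are a peak opening a block, a double ascent extending a block to its
  left, and a valley merging two blocks. The fourth kind of insertion would be a double
  descent.\<close>

lemma sep_words_step:
  assumes "v < n"
  shows "sep_words n v c k =
    (if c = 0 then {} else ins_class n (Suc v) False False (c - 1) k) \<union>
    ins_class n (Suc v) False True c k \<union>
    (if k = 0 then {} else ins_class n (Suc v) True True (Suc c) (k - 1))" (is "_ = ?R")
proof -
  have "xs \<in> sep_words n v c k \<longleftrightarrow> xs \<in> ?R" if xs: "sep_word n v xs" for xs
  proof -
    obtain l r as bs where *: "xs = ins (Suc v) l r as bs" "sep_word n (Suc v) (as @ 0 # bs)"
      "l \<longrightarrow> as \<noteq> []" "r \<longrightarrow> bs \<noteq> []"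
      using sep_word_ins_cases[OF assms xs] by blast
    define ys where "ys = as @ 0 # bs"
    have cls: "xs \<in> ins_class n (Suc v) l' r' c' k' \<longleftrightarrow>
        l' = l \<and> r' = r \<and> ys \<in> sep_words n (Suc v) c' k'" for l' r' c' k'
      unfolding *(1) ys_def by (rule mem_ins_class_iff[OF assms *(2-4)])
    have "xs \<in> sep_words n v c k \<longleftrightarrow> (l \<longrightarrow> r) \<and>
        (\<exists>k'. k = k' + of_bool (l \<and> r) \<and>
          ys \<in> sep_words n (Suc v) (c + of_bool l + of_bool r - 1) k') \<and>
        0 < c + of_bool l + of_bool r"
      unfolding *(1) ys_def by (rule ins_mem_sep_words[OF assms *(2-4)])
    moreover have "xs \<in> ?R \<longleftrightarrow> (0 < c \<and> \<not> l \<and> \<not> r \<and> ys \<in> sep_words n (Suc v) (c - 1) k) \<or>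
        (\<not> l \<and> r \<and> ys \<in> sep_words n (Suc v) c k) \<or>
        (0 < k \<and> l \<and> r \<and> ys \<in> sep_words n (Suc v) (Suc c) (k - 1))"
      by (simp add: cls)
    ultimately show ?thesis
      by (cases l; cases r; cases k; simp add: conj_commute)
  qed
  moreover have "sep_word n v xs" if "xs \<in> ?R" for xs
  proof -
    have "sep_word n v xs" if "xs \<in> ins_class n (Suc v) l r c k" for l r c k
      using ins_class_subset[OF assms that] sep_word_ins[OF assms] by metis
    then show ?thesis using that by (auto split: if_splits)
  qed
  moreover have "sep_word n v xs" if "xs \<in> sep_words n v c k" for xs
    using that by (simp add: sep_words_def)
  ultimately show ?thesis by blast
qed

lemma ins_class_disjoint:
  assumes "v < n" "(l, r) \<noteq> (l', r')"
  shows "ins_class n (Suc v) l r c k \<inter> ins_class n (Suc v) l' r' c' k' = {}"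
proof (rule ccontr)
  assume "\<not> ?thesis"
  then obtain xs where xs: "xs \<in> ins_class n (Suc v) l r c k" "xs \<in> ins_class n (Suc v) l' r' c' k'"
    by blast
  obtain as bs where *: "xs = ins (Suc v) l r as bs" "sep_word n (Suc v) (as @ 0 # bs)"
    "l \<longrightarrow> as \<noteq> []" "r \<longrightarrow> bs \<noteq> []"
    using ins_class_subset[OF assms(1) xs(1)] by blast
  show False
    using xs(2) assms(2) unfolding *(1) mem_ins_class_iff[OF assms(1) *(2-4)] by simp
qed

lemma finite_ins_class: "finite (ins_class n w l r c k)"
  by (simp add: ins_class_def finite_sep_words finite_splits)

lemma pqint_0 [simp]: "pqint p q 0 = 0"
  by (simp add: pqint_def)

lemma word_sum_step:
  assumes "v < n"
  shows "word_sum p q n v c k = pqint p q c *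
    ((if c = 0 then 0 else word_sum p q n (Suc v) (c - 1) k) + word_sum p q n (Suc v) c k +
     (if k = 0 then 0 else word_sum p q n (Suc v) (Suc c) (k - 1)))"
proof -
  let ?P = "if c = 0 then {} else ins_class n (Suc v) False False (c - 1) k"
  let ?D = "ins_class n (Suc v) False True c k"
  let ?V = "if k = 0 then {} else ins_class n (Suc v) True True (Suc c) (k - 1)"
  have "word_sum p q n v c k = (\<Sum>xs\<in>?P \<union> ?D \<union> ?V. pq_weight p q xs)"
    unfolding word_sum_def sep_words_step[OF assms] ..
  also have "\<dots> = (\<Sum>xs\<in>?P \<union> ?D. pq_weight p q xs) + (\<Sum>xs\<in>?V. pq_weight p q xs)"
    by (intro sum.union_disjoint)
      (simp_all add: finite_ins_class ins_class_disjoint[OF assms] Int_Un_distrib2)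
  also have "(\<Sum>xs\<in>?P \<union> ?D. pq_weight p q xs) =
      (\<Sum>xs\<in>?P. pq_weight p q xs) + (\<Sum>xs\<in>?D. pq_weight p q xs)"
    by (intro sum.union_disjoint)
      (simp_all add: finite_ins_class ins_class_disjoint[OF assms] Int_Un_distrib2)
  finally show ?thesis
    using assms by (auto simp: sum_ins_class[where c = c] algebra_simps)
qed

lemma sep_words_empty: "sep_words n n c k = (if c = 0 \<and> k = 0 then {[0]} else {})"
proof -
  have only: "xs = [0]" if "sep_word n n xs" for xs
  proof -
    have "xs = 0 # tl xs" using that by (cases xs) (simp_all add: sep_word_def)
    then obtain ys where xs: "xs = 0 # ys" ..
    have "ys = []"
      using that by (cases ys) (auto simp: xs sep_word_def)
    then show ?thesis by (simp add: xs)
  qed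
  have zero: "sep_word n n [0]" by (simp add: sep_word_def)
  have "xs \<in> sep_words n n c k \<longleftrightarrow> xs = [0] \<and> c = 0 \<and> k = 0" for xs
  proof (cases "xs = [0]")
    case True
    show ?thesis unfolding True using zero by (auto simp: sep_words_def)
  next
    case False
    then have "\<not> sep_word n n xs" using only by blast
    then show ?thesis using False by (simp add: sep_words_def)
  qed
  then show ?thesis by auto
qed

text \<open>The arguments count inserted values, blocks, and valleys.\<close>

fun gamma_rec :: "'a::comm_ring_1 \<Rightarrow> 'a \<Rightarrow> nat \<Rightarrow> nat \<Rightarrow> nat \<Rightarrow> 'a" where
  "gamma_rec p q 0 c k = (if c = 0 \<and> k = 0 then 1 else 0)"
| "gamma_rec p q (Suc m) c k = pqint p q c *
    ((if c = 0 then 0 else gamma_rec p q m (c - 1) k) + gamma_rec p q m c k +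
     (if k = 0 then 0 else gamma_rec p q m (Suc c) (k - 1)))"

text \<open>Values enter in decreasing order from \<open>n\<close>, so after \<open>m\<close>
  insertions exactly those above \<open>n - m\<close> are present.\<close>

lemma word_sum_eq_gamma_rec: "m \<le> n \<Longrightarrow> word_sum p q n (n - m) c k = gamma_rec p q m c k"
proof (induction m arbitrary: c k)
  case 0
  have "drop_stat [0] = 0" by (simp add: drop_stat_def)
  then show ?case by (simp add: word_sum_def sep_words_empty pq_weight_def)
next
  case (Suc m)
  then have "Suc (n - Suc m) = n - m" "n - Suc m < n" by auto
  then show ?case using Suc by (simp add: word_sum_step)
qed

section \<open>Words of permutations\<close>

definition perm_word :: "nat \<Rightarrow> (nat \<Rightarrow> nat) \<Rightarrow> nat list" where
  "perm_word n f = 0 # map f [1..<Suc n] @ [0]"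

lemma perm_word_split:
  assumes "j \<in> {1..n}"
  shows "perm_word n f = (0 # map f [1..<j]) @ f j # map f [Suc j..<Suc n] @ [0]"
proof -
  have "[1..<Suc n] = [1..<j] @ j # [Suc j..<Suc n]"
    using assms upt_add_eq_append[of 1 j "Suc n - j"] by (simp add: upt_conv_Cons)
  then show ?thesis by (simp add: perm_word_def)
qed

lemma before_split: "u \<notin> set as \<Longrightarrow> before u (as @ u # bs) = as"
  by (simp add: before_append) (simp add: before_def)

lemma before_perm_word:
  assumes "inj_on f {1..n}" "0 \<notin> f ` {1..n}" "j \<in> {1..n}"
  shows "before (f j) (perm_word n f) = 0 # map f [1..<j]"
proof -
  have "f j \<notin> f ` {1..<j}"
    using assms(3) by (subst inj_on_image_mem_iff[OF assms(1)]) auto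
  moreover have "f j \<noteq> 0" using assms(2,3) by force
  ultimately have "f j \<notin> set (0 # map f [1..<j])" by (simp add: atLeastLessThan_def)
  then show ?thesis
    unfolding perm_word_split[OF assms(3)] by (rule before_split)
qed

lemma drops_map_upt:
  "drops u (map f [1..<j]) = card {i. 2 \<le> i \<and> i < j \<and> f (i - 1) > u \<and> u > f i}"
proof (induction j)
  case (Suc j)
  let ?A = "\<lambda>j. {i. 2 \<le> i \<and> i < j \<and> f (i - 1) > u \<and> u > f i}"
  show ?case
  proof (cases "2 \<le> j")
    case True
    then obtain k where k: "j = Suc k" "1 \<le> k" by (cases j) auto
    have "map f [1..<Suc j] = map f [1..<k] @ f k # [f j]"
      using k by simp
    then have "drops u (map f [1..<Suc j]) = drops u (map f [1..<j]) + drops u [f k, f j]"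
      using drops_append[of u "map f [1..<k]" "f k" "[f j]"] k by simp
    moreover have "?A (Suc j) = ?A j \<union> (if f (j - 1) > u \<and> u > f j then {j} else {})"
      using True by (auto simp: less_Suc_eq)
    moreover have "finite (?A j)" by simp
    ultimately show ?thesis
      using Suc.IH k by (auto simp: card_insert_if)
  next
    case False
    then have "?A (Suc j) = {}" by auto
    moreover have "j = 0 \<or> j = 1" using False by auto
    then have "drops u (map f [1..<Suc j]) = 0" by auto
    ultimately show ?thesis by simp
  qed
qed simp

text \<open>Stated for injective \<open>f\<close> rather than permutations so that it also covers
  \<open>\<lambda>i. f (Suc n - i)\<close>, which need not be the identity outside
  \<open>{1..n}\<close>.\<close>

lemma drop_stat_perm_word:
  assumes "inj_on f {1..n}" "0 \<notin> f ` {1..n}"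
  shows "drop_stat (perm_word n f) = pat_31_2 n f"
proof -
  define A where "A j = {i. 2 \<le> i \<and> i < j \<and> f (i - 1) > f j \<and> f j > f i}" for j
  have "set (perm_word n f) - {0} = f ` {1..n}"
    using assms(2) by (auto simp: perm_word_def)
  then have "drop_stat (perm_word n f) = (\<Sum>j\<in>{1..n}. drops (f j) (before (f j) (perm_word n f)))"
    unfolding drop_stat_def by (simp only: sum.reindex[OF assms(1)] comp_def)
  also have "\<dots> = (\<Sum>j\<in>{1..n}. card (A j))"
  proof (rule sum.cong[OF refl])
    fix j assume j: "j \<in> {1..n}"
    \<comment> \<open>Positivity makes the leading separator smaller than \<open>f j\<close>, so it
      cannot start a drop.\<close>
    then have "0 < f j" using assms(2) by (metis gr0I imageI)
    then show "drops (f j) (before (f j) (perm_word n f)) = card (A j)"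
      unfolding before_perm_word[OF assms j] A_def
      by (simp only: drops_small_Cons drops_map_upt)
  qed
  also have "\<dots> = card (SIGMA j:{1..n}. A j)"
    by (rule card_SigmaI[symmetric]) (simp_all add: A_def)
  also have "\<dots> = card (prod.swap ` (SIGMA j:{1..n}. A j))"
    by (simp add: card_image)
  also have "prod.swap ` (SIGMA j:{1..n}. A j) =
      {(i, j). 2 \<le> i \<and> i < j \<and> j \<le> n \<and> f (i - 1) > f j \<and> f j > f i}"
    by (auto simp: A_def image_def)
  finally show ?thesis by (simp add: pat_31_2_def)
qed

lemma rev_perm_word: "rev (perm_word n f) = perm_word n (\<lambda>i. f (Suc n - i))"
proof -
  have "rev [1..<Suc n] = map (\<lambda>i. Suc n - i) [1..<Suc n]"
    by (rule nth_equalityI) (simp_all add: rev_nth del: upt_Suc)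
  then show ?thesis
    by (simp add: perm_word_def rev_map del: upt_Suc)
qed

text \<open>Reversal sends the positions \<open>i - 1\<close>, \<open>i\<close>, \<open>j\<close> of
  a 31-2 to \<open>Suc n - i + 1\<close>, \<open>Suc n - i\<close>, \<open>Suc n - j\<close>, which
  are those of a 2-13.\<close>

lemma pat_31_2_reverse: "pat_31_2 n (\<lambda>i. f (Suc n - i)) = pat_2_13 n f"
proof -
  have "bij_betw (\<lambda>(i, j). (Suc n - j, Suc n - i))
      {(i, j). 2 \<le> i \<and> i < j \<and> j \<le> n \<and> f (Suc n - (i - 1)) > f (Suc n - j) \<and>
         f (Suc n - j) > f (Suc n - i)}
      {(i, j). 1 \<le> i \<and> i < j \<and> j \<le> n - 1 \<and> f (j + 1) > f i \<and> f i > f j}"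
    by (rule bij_betw_byWitness[where f' = "\<lambda>(i, j). (Suc n - j, Suc n - i)"])
      (auto simp: Suc_diff_le)
  then show ?thesis
    unfolding pat_31_2_def pat_2_13_def by (rule bij_betw_same_card)
qed

lemma big_left_perm_word:
  assumes "inj_on f {1..n}" "0 \<notin> f ` {1..n}" "j \<in> {1..n}"
  shows "big_left (f j) (perm_word n f) \<longleftrightarrow> f j < pad n f (j - 1)"
proof -
  have "last (0 # map f [1..<j]) = pad n f (j - 1)"
  proof (cases "j = 1")
    case False
    then obtain k where "j = Suc k" "1 \<le> k" using assms(3) by (cases j) auto
    then show ?thesis using assms(3) by (simp add: pad_def)
  qed (simp add: pad_def)
  then show ?thesis
    unfolding big_left_def before_perm_word[OF assms] by (simp only:)
qed

lemma perm_reverse: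
  assumes "inj_on f {1..n}" "0 \<notin> f ` {1..n}"
  shows "inj_on (\<lambda>i. f (Suc n - i)) {1..n}" "0 \<notin> (\<lambda>i. f (Suc n - i)) ` {1..n}"
proof -
  have eq: "(\<lambda>i. f (Suc n - i)) = f \<circ> (\<lambda>i. Suc n - i)" by auto
  have "inj_on (\<lambda>i. Suc n - i) {1..n}" by (auto simp: inj_on_def)
  moreover have im: "(\<lambda>i. Suc n - i) ` {1..n} \<subseteq> {1..n}" by auto
  ultimately show "inj_on (\<lambda>i. f (Suc n - i)) {1..n}"
    unfolding eq using assms(1) by (intro comp_inj_on) (auto intro: inj_on_subset)
  show "0 \<notin> (\<lambda>i. f (Suc n - i)) ` {1..n}"
    unfolding eq image_comp[symmetric] using assms(2) im by blast
qed

lemma big_left_rev_perm_word: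
  assumes "inj_on f {1..n}" "0 \<notin> f ` {1..n}" "j \<in> {1..n}"
  shows "big_left (f j) (rev (perm_word n f)) \<longleftrightarrow> f j < pad n f (j + 1)"
proof -
  have j: "Suc n - j \<in> {1..n}" "Suc n - (Suc n - j) = j" using assms(3) by auto
  have "pad n (\<lambda>i. f (Suc n - i)) (Suc n - j - 1) = pad n f (j + 1)"
    using assms(3) by (auto simp: pad_def)
  then show ?thesis
    using big_left_perm_word[OF perm_reverse[OF assms(1,2)] j(1)]
    unfolding rev_perm_word j(2) by simp
qed

lemma sep_word_perm_word:
  assumes "s permutes {1..n}" "1 \<le> n"
  shows "sep_word n 0 (perm_word n s) \<and> count_list (perm_word n s) 0 = 2"
proof -
  have im: "s ` {1..n} = {1..n}" using assms(1) by (rule permutes_image)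
  have set: "set (map s [1..<Suc n]) = {1..n}"
    using im by (simp add: atLeastLessThanSuc_atLeastAtMost del: upt_Suc)
  have ne: "map s [1..<Suc n] \<noteq> []" using assms(2) by simp
  have dist: "distinct (map s [1..<Suc n])"
    using permutes_inj_on[OF assms(1)] by (simp add: distinct_map del: upt_Suc)
  define w where "w = map s [1..<Suc n]"
  have nz: "\<forall>x\<in>set w. x \<noteq> 0" using set by (auto simp: w_def)
  then have "successively (\<lambda>a b. a \<noteq> 0 \<or> b \<noteq> 0) w"
    by (induction w rule: induct_list012) auto
  moreover have "w \<noteq> []" using ne unfolding w_def .
  moreover from this have "hd w \<noteq> 0" "last w \<noteq> 0" using nz by simp_all
  moreover have "filter (\<lambda>x. x \<noteq> 0) w = w" using nz by (simp add: filter_id_conv)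
  moreover have "0 \<notin> set w" using nz by blast
  moreover have "perm_word n s = 0 # w @ [0]" by (simp only: perm_word_def w_def)
  moreover have "insert 0 {1..n} = insert 0 {0<..n}" by auto
  ultimately show ?thesis
    using dist set unfolding w_def[symmetric]
    by (simp add: sep_word_def successively_Cons successively_append_iff count_list_0_iff)
qed

text \<open>Two separators can only be the two ends, so the letters between them are the values
  \<open>1\<close> to \<open>n\<close>, each once.\<close>

lemma sep_word_obtain_perm:
  assumes "sep_word n 0 xs" "count_list xs 0 = 2"
  obtains s where "s permutes {1..n}" "xs = perm_word n s"
proof -
  have H: "hd xs = 0" "last xs = 0" "xs \<noteq> []" "distinct (filter (\<lambda>x. x \<noteq> 0) xs)"
    "set xs = insert 0 {0<..n}"
    using assms(1) by (simp_all add: sep_word_def)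
  obtain ys where ys: "xs = 0 # ys" using H(1,3) by (cases xs) auto
  have "ys \<noteq> []" using assms(2) ys by auto
  then obtain w where w: "xs = 0 # w @ [0]"
    using H(2) ys by (cases ys rule: rev_cases) auto
  have "0 \<notin> set w" using assms(2) by (simp add: w count_list_0_iff)
  then have "filter (\<lambda>x. x \<noteq> 0) w = w"
    unfolding filter_id_conv by (metis neq0_conv)
  then have dist: "distinct w" using H(4) by (simp add: w)
  have "insert 0 (set w) = insert 0 {0<..n}" using H(5) by (simp add: w)
  then have "set w = {0<..n}"
    by (rule iffD1[OF insert_ident[OF \<open>0 \<notin> set w\<close>], rotated]) simp
  also have "{0<..n} = {1..n}" by auto
  finally have set: "set w = {1..n}" .
  then have len: "length w = n" using distinct_card[OF dist] by simp
  define s where "s i = (if i \<in> {1..n} then w ! (i - 1) else i)" for i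
  have map: "map s [1..<Suc n] = w"
    by (rule nth_equalityI) (simp_all add: len s_def del: upt_Suc)
  have "s ` {1..n} = {1..n}"
    using arg_cong[OF map, of set] set by (simp add: atLeastLessThanSuc_atLeastAtMost del: upt_Suc)
  then have "bij_betw s {1..n} {1..n}"
    by (simp add: bij_betw_def eq_card_imp_inj_on)
  then have "s permutes {1..n}"
    by (rule bij_imp_permutes) (auto simp: s_def)
  moreover have "xs = perm_word n s"
    unfolding w perm_word_def map ..
  ultimately show ?thesis by (rule that)
qed

lemma perm_word_inject:
  assumes "s permutes {1..n}" "s' permutes {1..n}" "perm_word n s = perm_word n s'"
  shows "s = s'"
proof
  fix i
  have "map s [1..<Suc n] = map s' [1..<Suc n]" using assms(3) by (simp add: perm_word_def)
  then have "\<forall>i\<in>{1..<Suc n}. s i = s' i"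
    unfolding map_eq_conv set_upt .
  then show "s i = s' i"
    using assms(1,2) by (cases "i \<in> {1..n}") (auto simp: permutes_not_in)
qed

lemma perm_word_mem_sep_words:
  assumes s: "s permutes {1..n}" and "1 \<le> n"
  shows "perm_word n s \<in> sep_words n 0 1 k \<longleftrightarrow> s \<in> perms_valley n k"
proof -
  have im: "s ` {1..n} = {1..n}" using s by (rule permutes_image)
  have inj: "inj_on s {1..n}" using s by (rule permutes_inj_on)
  have s0: "0 \<notin> s ` {1..n}" unfolding im by simp
  have range: "{0<..n} = s ` {1..n}" unfolding im by auto
  note bl = big_left_perm_word[OF inj s0] big_left_rev_perm_word[OF inj s0]
  have pad: "pad n s j = s j" if "j \<in> {1..n}" for j using that by (simp add: pad_def)
  \<comment> \<open>Adjacent entries differ, also across the right end where the padding is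
    \<open>0\<close>. Not being smaller than the right neighbour is therefore the same as being
    larger.\<close>
  have pad_ne: "s j \<noteq> pad n s (j + 1)" if "j \<in> {1..n}" for j
  proof (cases "j + 1 \<in> {1..n}")
    case True
    then show ?thesis using inj_onD[OF inj, of j "j + 1"] that by (auto simp: pad)
  next
    case False
    then show ?thesis using s0 that by (auto simp: pad_def image_def)
  qed
  have "(\<forall>u\<in>{0<..n}. big_left u (perm_word n s) \<longrightarrow> big_left u (rev (perm_word n s))) \<longleftrightarrow>
      double_descents n s = {}"
  proof -
    have "(\<forall>u\<in>{0<..n}. big_left u (perm_word n s) \<longrightarrow> big_left u (rev (perm_word n s))) \<longleftrightarrow>
        (\<forall>j\<in>{1..n}. s j < pad n s (j - 1) \<longrightarrow> s j < pad n s (j + 1))"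
      unfolding range ball_simps by (simp only: bl cong: ball_cong)
    also have "\<dots> \<longleftrightarrow> (\<forall>j\<in>{1..n}. \<not> (pad n s (j - 1) > pad n s j \<and> pad n s j > pad n s (j + 1)))"
      using pad pad_ne by (intro ball_cong refl) (metis linorder_neqE_nat less_asym)
    also have "\<dots> \<longleftrightarrow> double_descents n s = {}"
      unfolding double_descents_def by blast
    finally show ?thesis .
  qed
  moreover have "{u\<in>{0<..n}. big_left u (perm_word n s) \<and> big_left u (rev (perm_word n s))} =
      valleys n s"
  proof -
    have "{u\<in>{0<..n}. big_left u (perm_word n s) \<and> big_left u (rev (perm_word n s))} =
        s ` {j\<in>{1..n}. big_left (s j) (perm_word n s) \<and> big_left (s j) (rev (perm_word n s))}"
      unfolding range by blast
    also have "\<dots> = s ` {j\<in>{1..n}. pad n s (j - 1) > pad n s j \<and> pad n s j < pad n s (j + 1)}"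
      by (simp only: bl pad cong: conj_cong)
    also have "\<dots> = valleys n s"
      unfolding valleys_def by blast
    finally show ?thesis .
  qed
  ultimately show ?thesis
    using sep_word_perm_word[OF assms] s
    unfolding sep_words_def perms_valley_def mem_Collect_eq by (simp add: conj_commute)
qed

lemma sum_perms_valley:
  assumes "1 \<le> n"
  shows "(\<Sum>s\<in>perms_valley n k. p ^ pat_2_13 n s * q ^ pat_31_2 n s) =
    (\<Sum>xs\<in>sep_words n 0 1 k. pq_weight p q xs)"
proof -
  have "bij_betw (perm_word n) (perms_valley n k) (sep_words n 0 1 k)"
    unfolding bij_betw_def
  proof (intro conjI equalityI subsetI)
    show "inj_on (perm_word n) (perms_valley n k)"
      by (rule inj_onI) (auto simp: perms_valley_def intro: perm_word_inject)
  next
    fix xs assume "xs \<in> perm_word n ` perms_valley n k"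
    then show "xs \<in> sep_words n 0 1 k"
      using perm_word_mem_sep_words[OF _ assms] by (auto simp: perms_valley_def)
  next
    fix xs assume xs: "xs \<in> sep_words n 0 1 k"
    then obtain s where s: "s permutes {1..n}" "xs = perm_word n s"
      using sep_word_obtain_perm[of n xs] by (auto simp: sep_words_def)
    then show "xs \<in> perm_word n ` perms_valley n k"
      using xs perm_word_mem_sep_words[OF s(1) assms] by blast
  qed
  from sum.reindex_bij_betw[OF this, of "pq_weight p q"]
  have "(\<Sum>xs\<in>sep_words n 0 1 k. pq_weight p q xs) =
      (\<Sum>s\<in>perms_valley n k. pq_weight p q (perm_word n s))" by simp
  also have "\<dots> = (\<Sum>s\<in>perms_valley n k. p ^ pat_2_13 n s * q ^ pat_31_2 n s)"
  proof (rule sum.cong[OF refl])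
    fix s assume "s \<in> perms_valley n k"
    then have s: "s permutes {1..n}" by (simp add: perms_valley_def)
    have inj: "inj_on s {1..n}" "0 \<notin> s ` {1..n}"
      unfolding permutes_image[OF s] using permutes_inj_on[OF s] by simp_all
    show "pq_weight p q (perm_word n s) = p ^ pat_2_13 n s * q ^ pat_31_2 n s"
      unfolding pq_weight_def rev_perm_word drop_stat_perm_word[OF inj]
        drop_stat_perm_word[OF perm_reverse[OF inj]] pat_31_2_reverse
      by (rule mult.commute)
  qed
  finally show ?thesis by (rule sym)
qed

section \<open>Comparison of the two path models\<close>

text \<open>Peaks open blocks and each valley merges two, so \<open>c\<close> blocks and
  \<open>k\<close> valleys need \<open>c + k\<close> peaks, and together with the valleys at least
  \<open>2 * k + c\<close> values.\<close>

lemma gamma_rec_eq_0: "m < 2 * k + c \<Longrightarrow> gamma_rec p q m c k = 0"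
  by (induction m arbitrary: c k) auto

text \<open>Every valley is weighted by \<open>x\<close> and every double ascent by
  \<open>1 + x\<close>: with \<open>c + k\<close> peaks and \<open>k\<close> valleys among
  \<open>m\<close> values, \<open>m - 2 * k - c\<close> double ascents remain.\<close>

definition gamma_sum :: "'a::comm_ring_1 \<Rightarrow> 'a \<Rightarrow> 'a \<Rightarrow> nat \<Rightarrow> nat \<Rightarrow> 'a" where
  "gamma_sum p q x m c = (\<Sum>k\<le>m. gamma_rec p q m c k * (x ^ k * (1 + x) ^ (m - 2 * k - c)))"

lemma gamma_sum_0: "gamma_sum p q x 0 c = (if c = 0 then 1 else 0)"
  by (simp add: gamma_sum_def)

lemma gamma_sum_Suc_0: "gamma_sum p q x (Suc m) 0 = 0"
  by (simp add: gamma_sum_def)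

lemma gamma_sum_Suc_Suc:
  "gamma_sum p q x (Suc m) (Suc c) = pqint p q (Suc c) *
     (gamma_sum p q x m c + (1 + x) * gamma_sum p q x m (Suc c) + x * gamma_sum p q x m (Suc (Suc c)))"
proof -
  define e where "e k = x ^ k * (1 + x) ^ (m - 2 * k - c)" for k
  have "gamma_sum p q x (Suc m) (Suc c) = pqint p q (Suc c) *
      ((\<Sum>k\<le>Suc m. gamma_rec p q m c k * e k) + (\<Sum>k\<le>Suc m. gamma_rec p q m (Suc c) k * e k) +
       (\<Sum>k\<le>Suc m. (if k = 0 then 0 else gamma_rec p q m (Suc (Suc c)) (k - 1)) * e k))"
    unfolding gamma_sum_def sum.distrib[symmetric] sum_distrib_left e_def
    by (intro sum.cong refl) (simp add: algebra_simps)
  also have "(\<Sum>k\<le>Suc m. gamma_rec p q m c k * e k) = gamma_sum p q x m c"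
    by (simp add: gamma_sum_def e_def gamma_rec_eq_0)
  also have "(\<Sum>k\<le>Suc m. gamma_rec p q m (Suc c) k * e k) = (1 + x) * gamma_sum p q x m (Suc c)"
  proof -
    have "gamma_rec p q m (Suc c) k * e k =
        (1 + x) * (gamma_rec p q m (Suc c) k * (x ^ k * (1 + x) ^ (m - 2 * k - Suc c)))" for k
    \<comment> \<open>Where the exponent would be truncated, the coefficient
      \<open>gamma_rec\<close> is zero.\<close>
    proof (cases "m < 2 * k + Suc c")
      case False
      then have "m - 2 * k - c = Suc (m - 2 * k - Suc c)" by simp
      then show ?thesis by (simp add: e_def mult_ac)
    qed (simp add: gamma_rec_eq_0)
    then show ?thesis
      by (simp add: gamma_sum_def sum_distrib_left gamma_rec_eq_0)
  qed
  also have "(\<Sum>k\<le>Suc m. (if k = 0 then 0 else gamma_rec p q m (Suc (Suc c)) (k - 1)) * e k) =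
      x * gamma_sum p q x m (Suc (Suc c))"
    unfolding sum.atMost_Suc_shift gamma_sum_def sum_distrib_left
    by (simp add: e_def mult_ac)
  finally show ?thesis .
qed

text \<open>The exponents are \<open>a + 2 * (c - a) = c + (c - a)\<close>, so a power of
  \<open>q\<close> splits off and the rest is the sum in reverse order.\<close>

lemma pqint_square: "pqint (q ^ 2) q (Suc c) = q ^ c * qint q (Suc c)"
proof -
  have "pqint (q ^ 2) q (Suc c) = (\<Sum>a<Suc c. q ^ c * q ^ (Suc c - Suc a))"
    unfolding pqint_def
  proof (rule sum.cong[OF refl])
    fix a assume "a \<in> {..<Suc c}"
    then have "a + 2 * (Suc c - 1 - a) = c + (Suc c - Suc a)" by auto
    then show "q ^ a * (q ^ 2) ^ (Suc c - 1 - a) = q ^ c * q ^ (Suc c - Suc a)"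
      by (simp only: power_mult[symmetric] power_add[symmetric])
  qed
  also have "\<dots> = q ^ c * (\<Sum>a<Suc c. q ^ a)"
    unfolding sum_distrib_left[symmetric]
    by (subst sum.nat_diff_reindex) simp
  finally show ?thesis by (simp only: qint_def)
qed

text \<open>Conjugating the transfer matrix of one path model into that of the other, with the
  denominators cleared.\<close>

lemma gamma_sum_eq_exc_path:
  "q ^ (\<Sum>{..g}) * gamma_sum (q ^ 2) q (q * t) (Suc m) (Suc g) =
     (\<Prod>i\<le>g. qint q (Suc i)) * exc_path q t m g"
proof (induction m arbitrary: g)
  case 0
  show ?case
    by (simp add: gamma_sum_Suc_Suc gamma_sum_0 pqint_square)
next
  case (Suc m)
  let ?G = "gamma_sum (q ^ 2) q (q * t) (Suc m)" and ?F = "\<lambda>g. \<Prod>i\<le>g. qint q (Suc i)"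
  \<comment> \<open>The exponent \<open>\<Sum>{..g}\<close> is a triangular number; lowering
    \<open>g\<close> by one frees a second factor \<open>q ^ g\<close>, which yields the up weight
    \<open>q ^ (2 * g)\<close>. At \<open>g = 0\<close> there is no word with zero blocks.\<close>
  have up: "q ^ (\<Sum>{..g}) * (q ^ g * ?G g) =
      (if g = 0 then 0 else q ^ (2 * g) * (?F (g - 1) * exc_path q t m (g - 1)))"
  proof (cases g)
    case (Suc h)
    have "q ^ (\<Sum>{..g}) * q ^ g = q ^ (2 * g) * q ^ (\<Sum>{..h})"
      unfolding power_add[symmetric] by (rule arg_cong[where f = "\<lambda>e. q ^ e"]) (simp add: Suc)
    then have "q ^ (\<Sum>{..g}) * (q ^ g * ?G g) = q ^ (2 * g) * (q ^ (\<Sum>{..h}) * ?G (Suc h))"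
      unfolding mult.assoc[symmetric] by (simp add: Suc)
    then show ?thesis using Suc.IH[of h] Suc by simp
  qed (simp add: gamma_sum_Suc_0)
  \<comment> \<open>The \<open>q\<close> in \<open>q * t\<close> supplies the missing factor for the
    next triangular number; this is where the substitution of \<open>q * t\<close> for
    \<open>x\<close> enters.\<close>
  have down: "q ^ (\<Sum>{..g}) * (q ^ g * (q * t * ?G (Suc (Suc g)))) =
      t * (?F (Suc g) * exc_path q t m (Suc g))"
    unfolding Suc.IH[of "Suc g", symmetric] by (simp add: power_add mult_ac)
  have "q ^ (\<Sum>{..g}) * gamma_sum (q ^ 2) q (q * t) (Suc (Suc m)) (Suc g) =
      qint q (Suc g) * (q ^ (\<Sum>{..g}) * (q ^ g * ?G g) +
        q ^ g * (1 + q * t) * (q ^ (\<Sum>{..g}) * ?G (Suc g)) +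
        q ^ (\<Sum>{..g}) * (q ^ g * (q * t * ?G (Suc (Suc g)))))"
    unfolding gamma_sum_Suc_Suc[of _ _ _ "Suc m"] pqint_square by (simp only: algebra_simps)
  also have "\<dots> = ?F g * exc_path q t (Suc m) g"
    unfolding up down Suc.IH[of g] by (cases g) (simp_all add: algebra_simps)
  finally show ?case .
qed

text \<open>At height \<open>0\<close> both conjugating factors equal \<open>1\<close>.\<close>

lemma sum_inv_exc_eq_gamma_sum:
  assumes "1 \<le> n"
  shows "(\<Sum>s | s permutes {1..n}. q ^ inv_count n s * t ^ exc_count n s) =
    gamma_sum (q ^ 2) q (q * t) n 1"
proof -
  obtain m where n: "n = Suc m" using assms by (cases n) auto
  show ?thesis
    unfolding n sum_inv_exc_eq_exc_path using gamma_sum_eq_exc_path[of q 0 t m]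
    by (simp add: qint_Suc)
qed

section \<open>Divisibility\<close>

lemma one_plus_dvd_qint: "1 + q dvd qint q (2 * j)"
proof (induction j)
  case (Suc j)
  have "qint q (2 * Suc j) = qint q (2 * j) + q ^ (2 * j) * (1 + q)"
    by (simp add: qint_Suc algebra_simps)
  then show ?case using Suc.IH by simp
qed simp

text \<open>One of two consecutive integers is even, so \<open>1 + q\<close> divides its
  \<open>q\<close>-integer. The powers of \<open>q\<close> split off have total exponent
  \<open>2 * c + 1\<close>, which leaves at least one factor \<open>q\<close>.\<close>

lemma dvd_pqint_pqint: "q * (1 + q) dvd pqint (q ^ 2) q (Suc c) * pqint (q ^ 2) q (Suc (Suc c))"
proof -
  have "1 + q dvd qint q (Suc c) * qint q (Suc (Suc c))"
  proof (cases "even c")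
    case True
    then obtain j where "Suc (Suc c) = 2 * Suc j" by (auto elim: evenE)
    then show ?thesis using one_plus_dvd_qint[of q "Suc j"] by simp
  next
    case False
    then obtain j where "Suc c = 2 * Suc j" by (auto elim!: oddE)
    then show ?thesis using one_plus_dvd_qint[of q "Suc j"] by simp
  qed
  then have "q * (1 + q) dvd q * (qint q (Suc c) * qint q (Suc (Suc c)))"
    by (rule mult_dvd_mono[OF dvd_refl])
  also have "\<dots> dvd q ^ (2 * c) * (q * (qint q (Suc c) * qint q (Suc (Suc c))))"
    by simp
  also have "\<dots> = pqint (q ^ 2) q (Suc c) * pqint (q ^ 2) q (Suc (Suc c))"
    unfolding mult_2 power_add by (simp add: pqint_square mult_ac)
  finally show ?thesis .
qed

text \<open>The product over \<open>i\<close> strengthens the claim for the induction: it keeps in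
  reserve one factor for each open block. A valley reducing \<open>Suc c\<close> blocks to
  \<open>c\<close> pairs its own factor with the reserved one for \<open>Suc c\<close>, and these
  two are consecutive.\<close>

lemma dvd_gamma_rec:
  "(\<Prod>i<c. pqint (q ^ 2) q (Suc i)) * (q * (1 + q)) ^ k dvd gamma_rec (q ^ 2) q m c k"
proof (induction m arbitrary: c k)
  case (Suc m)
  show ?case
  proof (cases c)
    case (Suc d)
    let ?P = "pqint (q ^ 2) q" and ?D = "\<lambda>c. \<Prod>i<c. pqint (q ^ 2) q (Suc i)" and ?x = "q * (1 + q)"
    have 1: "?D c * ?x ^ k dvd ?P c * gamma_rec (q ^ 2) q m d k"
      \<comment> \<open>A peak: its own factor is the one that has to be added to the
        reserve.\<close>
      using mult_dvd_mono[OF dvd_refl Suc.IH[of d k], of "?P c"] by (simp add: Suc mult_ac)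
    have 2: "?D c * ?x ^ k dvd ?P c * gamma_rec (q ^ 2) q m c k"
      using Suc.IH by (rule dvd_mult)
    have 3: "?D c * ?x ^ k dvd ?P c * gamma_rec (q ^ 2) q m (Suc c) (k - 1)" if "k \<noteq> 0"
    proof -
      obtain k' where k: "k = Suc k'" using not0_implies_Suc[OF \<open>k \<noteq> 0\<close>] ..
      have "?D c * ?x ^ k = ?x * (?D c * ?x ^ k')" by (simp add: k mult_ac)
      also have "\<dots> dvd (?P c * ?P (Suc c)) * (?D c * ?x ^ k')"
        unfolding Suc by (rule mult_dvd_mono[OF dvd_pqint_pqint dvd_refl])
      also have "\<dots> = ?P c * (?D (Suc c) * ?x ^ k')" by (simp add: mult_ac)
      also have "\<dots> dvd ?P c * gamma_rec (q ^ 2) q m (Suc c) k'"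
        using Suc.IH by (rule mult_dvd_mono[OF dvd_refl])
      finally show ?thesis by (simp add: k)
    qed
    show ?thesis
      using 1 2 3 by (cases "k = 0") (simp_all add: Suc distrib_left dvd_add)
  qed simp
qed simp

lemma dvd_gamma_rec_1: "q ^ k * (1 + q) ^ k dvd gamma_rec (q ^ 2) q m 1 k"
  using dvd_gamma_rec[where q = q and c = 1 and k = k and m = m]
  by (simp add: pqint_def power_mult_distrib)

section \<open>Passage to polynomials in two indeterminates\<close>

text \<open>Constants form a subring, so the recursion may be evaluated before or after the
  embedding. This links coefficients in \<open>int poly\<close> with identities used in
  \<open>int poly poly\<close>.\<close>

lemma gamma_rec_const_poly: "gamma_rec [:p:] [:q:] m c k = [:gamma_rec p q m c k:]"
proof -
  have "pqint [:p:] [:q:] c = [:pqint p q c:]" for c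
  proof -
    have "(\<Sum>a\<in>A. [:f a:]) = [:\<Sum>a\<in>A. f a:]" for A :: "nat set" and f :: "nat \<Rightarrow> 'a"
      by (induction A rule: infinite_finite_induct) simp_all
    then show ?thesis by (simp add: pqint_def poly_const_pow mult_ac)
  qed
  then show ?thesis
    by (induction m arbitrary: c k) (simp_all add: one_pCons)
qed

lemma pcompose_power: "pcompose (p ^ n) r = pcompose p r ^ n"
  for p r :: "'a::comm_semiring_1 poly"
  by (induction n) (simp_all add: pcompose_1 pcompose_mult)

text \<open>The substitution multiplies the coefficient of index \<open>i\<close> by
  \<open>a ^ i\<close>, which can be cancelled in a domain.\<close>

lemma pcompose_linear_inject:
  fixes a :: "'a::idom"
  assumes "pcompose p [:0, a:] = pcompose r [:0, a:]" "a \<noteq> 0"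
  shows "p = r"
proof (rule poly_eqI)
  fix i
  have "a ^ i * coeff p i = a ^ i * coeff r i"
    using arg_cong[OF assms(1), of "\<lambda>p. coeff p i"] by (simp only: coeff_pcompose_linear)
  then show "coeff p i = coeff r i" using assms(2) by simp
qed

theorem theorem5:
  fixes n :: nat
  assumes "n \<ge> 1"
  shows "\<exists>\<gamma> :: nat \<Rightarrow> int poly.
    (\<forall>k \<le> (n - 1) div 2. \<forall>i. coeff (\<gamma> k) i \<ge> 0) \<and>
    (\<Sum>s | s permutes {1..n}. smult (q_var ^ (inv_count n s - exc_count n s)) (t_var ^ exc_count n s))
      = (\<Sum>k \<le> (n - 1) div 2. smult (\<gamma> k) (t_var ^ k * (1 + t_var) ^ (n - 1 - 2 * k))) \<and>
    (\<forall>k \<le> (n - 1) div 2.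
      \<gamma> k = (\<Sum>s \<in> perms_valley n k. q_var ^ (2 * pat_2_13 n s + pat_31_2 n s)) \<and>
      q_var ^ k * (1 + q_var) ^ k dvd \<gamma> k)"
proof -
  define \<gamma> where "\<gamma> = gamma_rec (q_var ^ 2) q_var n 1"
  define Q :: "int poly poly" where "Q = [:q_var:]"
  \<comment> \<open>Both sides are compared after substituting \<open>q * t\<close> for
    \<open>t\<close>. This turns the exponent \<open>inv - exc\<close> of \<open>q\<close> into
    \<open>inv\<close>, the form in which the path identity is available.\<close>
  define T :: "int poly poly" where "T = [:0, q_var:]"
  have T: "T = Q * t_var" by (simp add: T_def Q_def)
  have sum_\<gamma>: "\<gamma> k = (\<Sum>s \<in> perms_valley n k. q_var ^ (2 * pat_2_13 n s + pat_31_2 n s))" for k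
  proof -
    have "\<gamma> k = word_sum (q_var ^ 2) q_var n 0 1 k"
      using word_sum_eq_gamma_rec[of n n "q_var ^ 2" q_var 1 k] by (simp add: \<gamma>_def)
    also have "\<dots> = (\<Sum>s \<in> perms_valley n k. (q_var ^ 2) ^ pat_2_13 n s * q_var ^ pat_31_2 n s)"
      unfolding word_sum_def by (rule sum_perms_valley[OF assms, symmetric])
    finally show ?thesis by (simp only: power_mult power_add)
  qed
  have nonneg: "coeff (\<gamma> k) i \<ge> 0" for k i
  proof -
    have "coeff (q_var ^ e) i \<ge> 0" for e
      using monom_altdef[of "1::int" e] coeff_monom[of "1::int" e i] by simp
    then show ?thesis unfolding sum_\<gamma> coeff_sum by (intro sum_nonneg) blast
  qed
  have dvd: "q_var ^ k * (1 + q_var) ^ k dvd \<gamma> k" for k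
    unfolding \<gamma>_def by (rule dvd_gamma_rec_1)
  define L where "L = (\<Sum>s | s permutes {1..n}.
    smult (q_var ^ (inv_count n s - exc_count n s)) (t_var ^ exc_count n s))"
  define R where "R = (\<Sum>k \<le> (n - 1) div 2.
    smult (\<gamma> k) (t_var ^ k * (1 + t_var) ^ (n - 1 - 2 * k)))"
  have t_T: "pcompose t_var T = T" by (simp add: pcompose_pCons)
  have "pcompose L T = (\<Sum>s | s permutes {1..n}. Q ^ inv_count n s * t_var ^ exc_count n s)"
    unfolding L_def pcompose_sum
  proof (rule sum.cong[OF refl])
    fix s assume "s \<in> {s. s permutes {1..n}}"
    then have "exc_count n s \<le> inv_count n s" by (simp add: exc_count_le_inv_count)
    then have Q: "Q ^ (inv_count n s - exc_count n s) * Q ^ exc_count n s = Q ^ inv_count n s"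
      by (simp add: power_add[symmetric])
    have "pcompose (smult (q_var ^ (inv_count n s - exc_count n s)) (t_var ^ exc_count n s)) T =
        smult (q_var ^ (inv_count n s - exc_count n s)) (T ^ exc_count n s)"
      by (simp only: pcompose_smult pcompose_power t_T)
    also have "\<dots> = Q ^ (inv_count n s - exc_count n s) * T ^ exc_count n s"
      by (simp add: Q_def poly_const_pow)
    also have "\<dots> = Q ^ inv_count n s * t_var ^ exc_count n s"
      by (simp only: T power_mult_distrib mult.assoc[symmetric] Q)
    finally show "pcompose (smult (q_var ^ (inv_count n s - exc_count n s)) (t_var ^ exc_count n s)) T =
        Q ^ inv_count n s * t_var ^ exc_count n s" .
  qed
  also have "\<dots> = gamma_sum (Q ^ 2) Q T n 1"
    unfolding T by (rule sum_inv_exc_eq_gamma_sum[OF assms])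
  also have "\<dots> = (\<Sum>k\<le>n. smult (\<gamma> k) (T ^ k * (1 + T) ^ (n - 1 - 2 * k)))"
    by (simp add: gamma_sum_def Q_def poly_const_pow gamma_rec_const_poly \<gamma>_def)
  also have "\<dots> = (\<Sum>k \<le> (n - 1) div 2. smult (\<gamma> k) (T ^ k * (1 + T) ^ (n - 1 - 2 * k)))"
    \<comment> \<open>The terms beyond \<open>(n - 1) div 2\<close> vanish, since
      \<open>n < 2 * k + 1\<close> there.\<close>
    using assms by (intro sum.mono_neutral_right) (auto simp: \<gamma>_def intro!: gamma_rec_eq_0)
  also have "\<dots> = pcompose R T"
    unfolding R_def by (simp add: pcompose_sum pcompose_smult pcompose_mult pcompose_power
        pcompose_add pcompose_1 t_T)
  finally have "L = R"
    unfolding T_def by (rule pcompose_linear_inject) simp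
  with sum_\<gamma> nonneg dvd show ?thesis
    unfolding L_def R_def by blast
qed

end
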